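(* Let $B$ be a standard Brownian motion started at $0$ and consider the reflected Brownian motion $|B|$ on $[0,t]$, $t>0$. For $x>0$ and $\varepsilon>0$, $$\mathbb{E}[N_t^{x,x+\varepsilon}]=2\sum_{k\ge0}\mathrm{erfc}\!\left[\frac{x+(2k+1)\varepsilon}{\sqrt{2t}}\right].$$
   Context: $N_t^{x,x+\varepsilon}$ is the number of points of the ($H_0$, superlevel set) persistence diagram of $|B|$ restricted to $[0,t]$ lying in $]-\infty,x]\times[x+\varepsilon,\infty[$, i.e. the number of connected components of $\{u\in[0,t]:|B_u|>x\}$ on which $|B|$ reaches $x+\varepsilon$; for $x>0$ it is the number of upcrossings of $|B|$ from $x$ to $x+\varepsilon$ completed by time $t$. $\mathrm{erfc}(x)=\frac{2}{\sqrt\pi}\int_x^\infty e^{-u^2}du$. *)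

theory Defs
  imports "HOL-Probability.Probability"
begin

text \<open>
  Only values at times \<open>s \<ge> 0\<close> are constrained. The start at \<open>0\<close> and the continuity of the paths
  are required almost surely. The second parameter of \<^const>\<open>normal_density\<close> is the standard
  deviation.
\<close>

locale standard_brownian_motion = prob_space M
  for M :: "'a measure" and B :: "real \<Rightarrow> 'a \<Rightarrow> real" +
  assumes measurable_BM: "\<And>s. 0 \<le> s \<Longrightarrow> B s \<in> borel_measurable M"
    and start_zero: "AE \<omega> in M. B 0 \<omega> = 0"
    and indep_increments:
      "\<And>(\<tau> :: nat \<Rightarrow> real) n. 0 \<le> \<tau> 0 \<Longrightarrow> (\<And>i. i < n \<Longrightarrow> \<tau> i \<le> \<tau> (Suc i)) \<Longrightarrow>
         indep_vars (\<lambda>_. borel) (\<lambda>i \<omega>. B (\<tau> (Suc i)) \<omega> - B (\<tau> i) \<omega>) {..<n}"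
    and gaussian_increments:
      "\<And>s u. 0 \<le> s \<Longrightarrow> s < u \<Longrightarrow>
         distributed M lborel (\<lambda>\<omega>. B u \<omega> - B s \<omega>) (normal_density 0 (sqrt (u - s)))"
    and continuous_paths: "AE \<omega> in M. continuous_on {0..} (\<lambda>s. B s \<omega>)"

text \<open>
  For continuous \<open>f\<close>, a connected component \<open>C\<close> of the superlevel set of \<open>f\<close> above \<open>x\<close> on \<open>[0,t]\<close> on which \<open>f\<close> reaches
  \<open>y\<close> is a bar of the superlevel \<open>H\<^sub>0\<close> persistence diagram in the quadrant \<open>]-\<infinity>,x] \<times> [y,\<infinity>[\<close>. The
  cardinality is taken in \<^typ>\<open>ennreal\<close>, so that an infinite family counts as \<open>\<infinity>\<close>.
\<close>

definition bar_count :: "(real \<Rightarrow> real) \<Rightarrow> real \<Rightarrow> real \<Rightarrow> real \<Rightarrow> ennreal" where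
  "bar_count f t x y =
     emeasure (count_space UNIV) {C \<in> components {u \<in> {0..t}. x < f u}. \<exists>u\<in>C. y \<le> f u}"

definition erfc :: "real \<Rightarrow> real" where
  "erfc x = 2 / sqrt pi * (LINT u:{x..}|lborel. exp (- u\<^sup>2))"

end

theory Submission
  imports Defs
begin

text \<open>
  For \<open>x > 0\<close> the bars of \<open>\<bar>B\<bar>\<close> are those of \<open>B\<close> together with those of \<open>-B\<close>, so it suffices to count
  the upcrossings of \<open>B\<close>. At least \<open>n + 1\<close> of them occur by time \<open>t\<close> iff \<open>B\<close> alternately passes above
  \<open>x + \<epsilon>\<close> and below \<open>x\<close>, \<open>2n + 1\<close> times in total. Reflecting the path successively at these passage times
  unfolds the alternation into a single passage above \<open>x + (2n + 1)\<epsilon>\<close>, and a last reflection shows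
  that this has probability \<open>2 P(B\<^sub>t > x + (2n + 1)\<epsilon>)\<close>. Summation over \<open>n\<close> gives the series.

  No strong Markov property is needed: the reflections are carried out for the random walk sampled on
  a dyadic grid, where reflecting means flipping the signs of the later increments. There the
  overshoot over the levels costs a shift by at most the largest increment, which tends to \<open>0\<close>
  in probability as the grid is refined.
\<close>


section \<open>Alternating level passages\<close>

text \<open>The band from \<open>x\<close> to \<open>x + \<epsilon>\<close> is written with centre
  \<open>c = x + \<epsilon> / 2\<close> and half width \<open>h = \<epsilon> / 2\<close>. After
  multiplication by \<open>(- 1) ^ j\<close>, upward and downward passages are the same statement,
  namely exceeding \<open>h\<close>, and each reflection moves the target by the full width
  \<open>2 * h\<close>. The obstacle is a mismatch of inequalities. A bar has only to reach
  \<open>c + h\<close>, and two bars may be separated by a value equal to \<open>c - h\<close>,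
  whereas only strict passages survive when times are rounded to a grid; a path that merely touches
  a level may be missed by every grid. Hence bars are turned into passages for every smaller half
  width, and the limiting probability is continuous in \<open>h\<close>, so the two events agree up
  to a null set. Two unrelated factors 2 occur. That of the last reflection is absorbed by the
  Gaussian tail, which equals \<open>erfc (a / sqrt (2 * t)) / 2\<close>; that of the theorem comes
  from the two signs of \<open>B\<close>.\<close>

text \<open>
  \<open>stage c h j i w\<close>: the \<open>j\<close>-th alternating passage of \<open>w\<close> takes place at time \<open>i\<close>. Passages number \<open>1, 3, \<dots>\<close>
  go above \<open>c + h\<close>, passages number \<open>2, 4, \<dots>\<close> go below \<open>c - h\<close>, and number \<open>0\<close> is the start.
\<close>

primrec stage :: "real \<Rightarrow> real \<Rightarrow> nat \<Rightarrow> nat \<Rightarrow> (nat \<Rightarrow> real) \<Rightarrow> bool" where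
  "stage c h 0 i w \<longleftrightarrow> i = 0"
| "stage c h (Suc j) i w \<longleftrightarrow> (\<exists>l<i. stage c h j l w \<and> (- 1) ^ j * (w i - c) > h \<and>
     (\<forall>m. l < m \<and> m < i \<longrightarrow> (- 1) ^ j * (w m - c) \<le> h))"

lemma stage_cong: "(\<And>l. l \<le> i \<Longrightarrow> w l = w' l) \<Longrightarrow> stage c h j i w = stage c h j i w'"
proof (induction j arbitrary: i)
  case (Suc j)
  then have "stage c h j l w = stage c h j l w'" if "l < i" for l
    using that by simp
  moreover have "w i = w' i"
    using Suc.prems by simp
  moreover have "w m = w' m" if "m < i" for m
    using Suc.prems that by simp_all
  ultimately show ?case
    by (simp cong: conj_cong)
qed simp

lemma stage_unique: "stage c h j i w \<Longrightarrow> stage c h j i' w \<Longrightarrow> i = i'"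
proof (induction j arbitrary: i i')
  case (Suc j)
  obtain l where l: "l < i" "stage c h j l w" "(- 1) ^ j * (w i - c) > h"
      "\<And>m. l < m \<Longrightarrow> m < i \<Longrightarrow> (- 1) ^ j * (w m - c) \<le> h"
    using Suc.prems(1) by auto
  obtain l' where l': "l' < i'" "stage c h j l' w" "(- 1) ^ j * (w i' - c) > h"
      "\<And>m. l' < m \<Longrightarrow> m < i' \<Longrightarrow> (- 1) ^ j * (w m - c) \<le> h"
    using Suc.prems(2) by auto
  have "l = l'" using Suc.IH l l' by blast
  then show ?case
    using l l' by (metis linorder_neqE_nat not_le)
qed simp

lemma pred_stage:
  assumes "\<And>l. l \<le> i \<Longrightarrow> w l \<in> borel_measurable K"
  shows "Measurable.pred K (\<lambda>\<omega>. stage c h j i (\<lambda>l. w l \<omega>))"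
  using assms
proof (induction j arbitrary: i)
  case (Suc j)
  have [measurable]: "Measurable.pred K (\<lambda>\<omega>. stage c h j l (\<lambda>l. w l \<omega>))" if "l \<in> {..<i}" for l
    using Suc that by simp
  have [measurable]: "w i \<in> borel_measurable K" using Suc.prems by simp
  have [measurable]: "w l \<in> borel_measurable K" if "l \<in> {..<i}" for l
    using Suc.prems that by simp
  have "Measurable.pred K (\<lambda>\<omega>. \<exists>l\<in>{..<i}. stage c h j l (\<lambda>l. w l \<omega>) \<and> (- 1) ^ j * (w i \<omega> - c) > h \<and>
     (\<forall>m\<in>{..<i}. l < m \<longrightarrow> (- 1) ^ j * (w m \<omega> - c) \<le> h))"
    by measurable
  then show ?case
    by (rule measurable_cong[THEN iffD1, rotated]) auto
qed simp

text \<open>At time \<open>l\<close> the path is not beyond the next level: for \<open>j = 0\<close>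
  by the bound on \<open>w 0\<close>, otherwise because passage \<open>j\<close> exceeded
  \<open>h \<ge> 0\<close> with the opposite sign. So \<open>n\<close> is strictly later than
  \<open>l\<close>, and the first time beyond the level after \<open>l\<close> is passage
  \<open>j + 1\<close>.\<close>

lemma stage_imp_next:
  assumes "stage c h j l w" "(- 1) ^ j * (w n - c) > h" "l \<le> n" "0 \<le> h" "w 0 \<le> c + h"
  shows "\<exists>i\<le>n. stage c h (Suc j) i w"
proof -
  have "(- 1) ^ j * (w l - c) \<le> h"
    using assms by (cases j) auto
  with assms have "l < n" by (metis le_neq_implies_less not_le)
  define P where "P i \<longleftrightarrow> l < i \<and> (- 1) ^ j * (w i - c) > h" for i
  have "P n"
    using \<open>l < n\<close> assms unfolding P_def by blast
  then obtain i where i: "P i" "\<And>m. m < i \<Longrightarrow> \<not> P m"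
    using exists_least_iff[of P] by blast
  then have "i \<le> n"
    using \<open>P n\<close> not_le by blast
  moreover have "stage c h (Suc j) i w"
    using assms(1) i unfolding stage.simps P_def not_less[symmetric] by blast
  ultimately show ?thesis by blast
qed

text \<open>One step before a first passage the level has not yet been exceeded, so the excess is at
  most the last step. This also holds if that earlier time is the previous passage, where the path
  is on the other side.\<close>

lemma stage_overshoot:
  assumes "stage c h (Suc j) i w" "0 \<le> h" "w 0 \<le> c + h"
  shows "\<exists>k. i = Suc k \<and> (- 1) ^ j * (w i - c) \<le> h + \<bar>w i - w k\<bar>"
proof -
  obtain l where l: "l < i" "stage c h j l w" "(- 1) ^ j * (w i - c) > h"
      "\<And>m. l < m \<Longrightarrow> m < i \<Longrightarrow> (- 1) ^ j * (w m - c) \<le> h"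
    using assms(1) by auto
  obtain k where k: "i = Suc k" using l(1) by (cases i) auto
  have "(- 1) ^ j * (w k - c) \<le> h"
  proof (cases "k = l")
    case True
    then show ?thesis using l assms by (cases j) auto
  qed (use l k in auto)
  moreover have "(- 1) ^ j * (w i - c) = (- 1) ^ j * (w k - c) + (- 1) ^ j * (w i - w k)"
    by (simp add: algebra_simps)
  moreover have "(- 1) ^ j * (w i - w k) \<le> \<bar>w i - w k\<bar>"
    by (cases "even j") auto
  ultimately have "(- 1) ^ j * (w i - c) \<le> h + \<bar>w i - w k\<bar>" by linarith
  with k show ?thesis by blast
qed

section \<open>Alternating chains without the first-passage condition\<close>

lemma stage_imp_chain:
  assumes "stage c h j i w"
  shows "\<exists>s. s 0 = 0 \<and> s j = i \<and> (\<forall>k<j. s k < s (Suc k) \<and> h < (- 1) ^ k * (w (s (Suc k)) - c))"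
  using assms
proof (induction j arbitrary: i)
  case (Suc j)
  then obtain l where l: "l < i" "stage c h j l w" "h < (- 1) ^ j * (w i - c)" by auto
  then obtain s where "s 0 = 0" "s j = l" "\<And>k. k < j \<Longrightarrow> s k < s (Suc k) \<and> h < (- 1) ^ k * (w (s (Suc k)) - c)"
    using Suc.IH by blast
  then show ?case
    using l by (intro exI[of _ "s(Suc j := i)"]) (auto simp: less_Suc_eq)
qed auto

text \<open>First passages are greedy: they come no later than the times of any other alternating
  chain. Unlike first passage times, chains are stable under refining the grid, lowering
  \<open>h\<close> and passing to continuous time, so all such transfers go through chains.\<close>

lemma chain_imp_stage:
  assumes "0 \<le> h" "w 0 \<le> c + h" "s 0 = 0"
    and "\<And>k. k < j \<Longrightarrow> s k < s (Suc k) \<and> h < (- 1) ^ k * (w (s (Suc k)) - c)"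
  shows "\<exists>i\<le>s j. stage c h j i w"
  using assms(4)
proof (induction j)
  case (Suc j)
  have "\<exists>i\<le>s j. stage c h j i w"
    by (rule Suc.IH) (rule Suc.prems, simp)
  then obtain i where i: "i \<le> s j" "stage c h j i w" by blast
  have "s j < s (Suc j)" "h < (- 1) ^ j * (w (s (Suc j)) - c)"
    using Suc.prems[of j] by blast+
  with i assms(1,2) show ?case
    by (intro stage_imp_next[of c h j i]) linarith+
qed (use assms(3) in simp)

section \<open>Reflection of symmetric random walks\<close>

locale symmetric_walk = prob_space M for M :: "'a measure" +
  fixes X :: "nat \<Rightarrow> 'a \<Rightarrow> real" and N :: nat
  assumes N_pos: "0 < N"
    and indep: "indep_vars (\<lambda>_. borel) X {..<N}"
    and symmetric: "i < N \<Longrightarrow> distr M borel (\<lambda>\<omega>. - X i \<omega>) = distr M borel (X i)"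
begin

definition walk :: "'a \<Rightarrow> nat \<Rightarrow> real" where
  "walk \<omega> i = (\<Sum>j<i. X j \<omega>)"

lemma measurable_X [measurable]: "i < N \<Longrightarrow> X i \<in> borel_measurable M"
  using indep unfolding indep_vars_def by auto

lemma measurable_walk [measurable]: "i \<le> N \<Longrightarrow> (\<lambda>\<omega>. walk \<omega> i) \<in> borel_measurable M"
  unfolding walk_def by (intro borel_measurable_sum measurable_X) auto

lemma pred_stage_walk [measurable]: "i \<le> N \<Longrightarrow> Measurable.pred M (\<lambda>\<omega>. stage c h j i (walk \<omega>))"
  using pred_stage[of i "\<lambda>i \<omega>. walk \<omega> i"] by simp

text \<open>By independence both joint laws are products of their marginals, and by symmetry a sign
  change leaves each marginal unchanged.\<close>

lemma distr_sign_flip: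
  "distr M (Pi\<^sub>M {..<N} (\<lambda>_. borel)) (\<lambda>\<omega>. \<lambda>j\<in>{..<N}. if j < i then X j \<omega> else - X j \<omega>)
   = distr M (Pi\<^sub>M {..<N} (\<lambda>_. borel)) (\<lambda>\<omega>. \<lambda>j\<in>{..<N}. X j \<omega>)" (is "?l = ?r")
proof -
  let ?Y = "\<lambda>j \<omega>. if j < i then X j \<omega> else - X j \<omega>"
  have "indep_vars (\<lambda>_. borel) (\<lambda>j \<omega>. (\<lambda>x. if j < i then x else - x) (X j \<omega>)) {..<N}"
    by (rule indep_vars_compose2[OF indep]) auto
  then have *: "indep_vars (\<lambda>_. borel) ?Y {..<N}" by simp
  have "?l = Pi\<^sub>M {..<N} (\<lambda>j. distr M borel (?Y j))"
    using * N_pos by (subst (asm) indep_vars_iff_distr_eq_PiM') auto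
  also have "\<dots> = Pi\<^sub>M {..<N} (\<lambda>j. distr M borel (X j))"
    by (intro PiM_cong refl, rename_tac j, case_tac "j < i") (auto simp: symmetric)
  also have "\<dots> = ?r"
    using indep N_pos by (subst (asm) indep_vars_iff_distr_eq_PiM') auto
  finally show ?thesis .
qed

text \<open>The reflection principle at a random time, reduced to fixed times. Passage times are
  unique, so the event splits into disjoint pieces over \<open>i\<close>. Whether passage
  \<open>j\<close> occurs at \<open>i\<close> depends on the first \<open>i\<close> steps only;
  flipping the remaining steps leaves this and \<open>walk \<omega> i\<close> alone and mirrors the
  end at \<open>walk \<omega> i\<close>.\<close>

lemma prob_reflect_stage:
  assumes [measurable]: "Measurable.pred (borel \<Otimes>\<^sub>M borel) (\<lambda>(p, q). R p q)"
  shows "prob {\<omega>\<in>space M. \<exists>i\<le>N. stage c h j i (walk \<omega>) \<and> R (walk \<omega> i) (walk \<omega> N)}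
    = prob {\<omega>\<in>space M. \<exists>i\<le>N. stage c h j i (walk \<omega>) \<and> R (walk \<omega> i) (2 * walk \<omega> i - walk \<omega> N)}"
proof -
  have split: "prob {\<omega>\<in>space M. \<exists>i\<le>N. stage c h j i (walk \<omega>) \<and> Q i \<omega>}
      = (\<Sum>i\<le>N. prob {\<omega>\<in>space M. stage c h j i (walk \<omega>) \<and> Q i \<omega>})"
    if [measurable]: "\<And>i. i \<le> N \<Longrightarrow> Measurable.pred M (Q i)" for Q
  proof -
    have "prob (\<Union>i\<in>{..N}. {\<omega>\<in>space M. stage c h j i (walk \<omega>) \<and> Q i \<omega>})
      = (\<Sum>i\<le>N. prob {\<omega>\<in>space M. stage c h j i (walk \<omega>) \<and> Q i \<omega>})"
      by (intro finite_measure_finite_Union)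
         (auto simp: disjoint_family_on_def dest: stage_unique)
    also have "(\<Union>i\<in>{..N}. {\<omega>\<in>space M. stage c h j i (walk \<omega>) \<and> Q i \<omega>})
      = {\<omega>\<in>space M. \<exists>i\<le>N. stage c h j i (walk \<omega>) \<and> Q i \<omega>}" by auto
    finally show ?thesis .
  qed
  have flip: "prob {\<omega>\<in>space M. stage c h j i (walk \<omega>) \<and> R (walk \<omega> i) (walk \<omega> N)}
    = prob {\<omega>\<in>space M. stage c h j i (walk \<omega>) \<and> R (walk \<omega> i) (2 * walk \<omega> i - walk \<omega> N)}"
    if "i \<le> N" for i
  proof -
    let ?P = "Pi\<^sub>M {..<N} (\<lambda>_. borel :: real measure)"
    define S where "S l v = (\<Sum>j<l. v j)" for l and v :: "nat \<Rightarrow> real"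
    have [measurable]: "S l \<in> borel_measurable ?P" if "l \<le> N" for l
      unfolding S_def using that by (intro borel_measurable_sum measurable_component_singleton) auto
    have [measurable]: "Measurable.pred ?P (\<lambda>v. stage c h j i (\<lambda>l. S l v))"
      using that by (intro pred_stage) auto
    \<comment> \<open>One event on the space of step sequences: pulled back along the original steps
      it is the left event, along the flipped steps the right one.\<close>
    define F where "F = {v\<in>space ?P. stage c h j i (\<lambda>l. S l v) \<and> R (S i v) (S N v)}"
    have F[measurable]: "F \<in> sets ?P"
      unfolding F_def using that by measurable
    let ?X = "\<lambda>\<omega>. \<lambda>j\<in>{..<N}. X j \<omega>"
    let ?Y = "\<lambda>\<omega>. \<lambda>j\<in>{..<N}. if j < i then X j \<omega> else - X j \<omega>"
    have X: "?X \<in> measurable M ?P"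
      by (auto intro!: measurable_restrict)
    have Y: "?Y \<in> measurable M ?P"
      by (intro measurable_restrict) auto
    have SX: "S l (?X \<omega>) = walk \<omega> l" if "l \<le> N" for l \<omega>
      unfolding S_def walk_def using that by (intro sum.cong) auto
    have SY: "S l (?Y \<omega>) = walk \<omega> l" if "l \<le> i" for l \<omega>
      unfolding S_def walk_def using that \<open>i \<le> N\<close> by (intro sum.cong) auto
    have SYN: "S N (?Y \<omega>) = 2 * walk \<omega> i - walk \<omega> N" for \<omega>
    proof -
      have "{..<N} = {..<i} \<union> {i..<N}" using that by auto
      then have u: "(\<Sum>j<N. g j) = (\<Sum>j<i. g j) + (\<Sum>j=i..<N. g j)" for g :: "nat \<Rightarrow> real"
        by (simp add: sum.union_disjoint ivl_disj_int)
      have "S N (?Y \<omega>) = (\<Sum>j<i. X j \<omega>) + (\<Sum>j=i..<N. - X j \<omega>)"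
        unfolding S_def u using that by (intro arg_cong2[where f="(+)"] sum.cong) auto
      then show ?thesis
        unfolding walk_def u by (simp add: sum_negf)
    qed
    have "prob (?X -` F \<inter> space M) = measure (distr M ?P ?X) F"
      by (rule measure_distr[OF X F, symmetric])
    also have "\<dots> = measure (distr M ?P ?Y) F"
      by (simp only: distr_sign_flip)
    also have "\<dots> = prob (?Y -` F \<inter> space M)"
      by (rule measure_distr[OF Y F])
    finally have "prob (?X -` F \<inter> space M) = prob (?Y -` F \<inter> space M)" .
    moreover have "?X -` F \<inter> space M
        = {\<omega>\<in>space M. stage c h j i (walk \<omega>) \<and> R (walk \<omega> i) (walk \<omega> N)}"
    proof -
      have "stage c h j i (\<lambda>l. S l (?X \<omega>)) = stage c h j i (walk \<omega>)" for \<omega>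
        using that SX by (intro stage_cong) auto
      then have "?X \<omega> \<in> F \<longleftrightarrow> stage c h j i (walk \<omega>) \<and> R (walk \<omega> i) (walk \<omega> N)" if "\<omega> \<in> space M" for \<omega>
        unfolding F_def mem_Collect_eq SX[OF order_refl] SX[OF \<open>i \<le> N\<close>]
        using measurable_space[OF X that] by blast
      then show ?thesis by blast
    qed
    moreover have "?Y -` F \<inter> space M
        = {\<omega>\<in>space M. stage c h j i (walk \<omega>) \<and> R (walk \<omega> i) (2 * walk \<omega> i - walk \<omega> N)}"
    proof -
      have "stage c h j i (\<lambda>l. S l (?Y \<omega>)) = stage c h j i (walk \<omega>)" for \<omega>
        using that SY by (intro stage_cong) auto
      then have "?Y \<omega> \<in> F \<longleftrightarrow> stage c h j i (walk \<omega>) \<and> R (walk \<omega> i) (2 * walk \<omega> i - walk \<omega> N)"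
        if "\<omega> \<in> space M" for \<omega>
        unfolding F_def mem_Collect_eq SY[OF order_refl] SYN
        using measurable_space[OF Y that] by blast
      then show ?thesis by blast
    qed
    ultimately show ?thesis
      by simp
  qed
  have "prob {\<omega>\<in>space M. \<exists>i\<le>N. stage c h j i (walk \<omega>) \<and> R (walk \<omega> i) (walk \<omega> N)}
      = (\<Sum>i\<le>N. prob {\<omega>\<in>space M. stage c h j i (walk \<omega>) \<and> R (walk \<omega> i) (walk \<omega> N)})"
    by (rule split) measurable
  also have "\<dots> = (\<Sum>i\<le>N. prob {\<omega>\<in>space M. stage c h j i (walk \<omega>)
      \<and> R (walk \<omega> i) (2 * walk \<omega> i - walk \<omega> N)})"
    by (intro sum.cong refl flip) simp
  also have "\<dots> = prob {\<omega>\<in>space M. \<exists>i\<le>N. stage c h j i (walk \<omega>)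
      \<and> R (walk \<omega> i) (2 * walk \<omega> i - walk \<omega> N)}"
    by (rule split[symmetric]) measurable
  finally show ?thesis .
qed

section \<open>Upper bounds by iterated reflection\<close>

lemma measurable_stage_event:
  assumes "\<And>i. i \<le> N \<Longrightarrow> Measurable.pred M (Q i)"
  shows "{\<omega>\<in>space M. \<exists>i\<le>N. stage c h j i (walk \<omega>) \<and> Q i \<omega>} \<in> events"
proof -
  have "{\<omega>\<in>space M. \<exists>i\<le>N. stage c h j i (walk \<omega>) \<and> Q i \<omega>}
      = (\<Union>i\<in>{..N}. {\<omega>\<in>space M. stage c h j i (walk \<omega>) \<and> Q i \<omega>})" by auto
  also have "\<dots> \<in> events"
    using assms by (intro sets.finite_UN) auto
  finally show ?thesis .
qed

text \<open>Each induction step trades the last passage for a gain of \<open>2 * h\<close>. The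
  passage lies beyond its level by more than \<open>h\<close>, so mirroring an end at signed
  distance \<open>d\<close> on the far side gives one beyond \<open>d + 2 * h\<close>; afterwards
  only passage \<open>j\<close> is remembered.\<close>

lemma prob_stage_end_le:
  "prob {\<omega>\<in>space M. \<exists>i\<le>N. stage c h j i (walk \<omega>) \<and> d \<le> (- 1) ^ j * (walk \<omega> N - c)}
   \<le> prob {\<omega>\<in>space M. d + 2 * real j * h \<le> walk \<omega> N - c}"
proof (induction j arbitrary: d)
  case (Suc j)
  have "prob {\<omega>\<in>space M. \<exists>i\<le>N. stage c h (Suc j) i (walk \<omega>) \<and> d \<le> (- 1) ^ Suc j * (walk \<omega> N - c)}
    = prob {\<omega>\<in>space M. \<exists>i\<le>N. stage c h (Suc j) i (walk \<omega>) \<and>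
        d \<le> (- 1) ^ Suc j * (2 * walk \<omega> i - walk \<omega> N - c)}"
    by (rule prob_reflect_stage) measurable
  also have "\<dots> \<le> prob {\<omega>\<in>space M. \<exists>i\<le>N. stage c h j i (walk \<omega>) \<and>
        d + 2 * h \<le> (- 1) ^ j * (walk \<omega> N - c)}"
  proof (rule finite_measure_mono)
    show "{\<omega>\<in>space M. \<exists>i\<le>N. stage c h (Suc j) i (walk \<omega>) \<and>
        d \<le> (- 1) ^ Suc j * (2 * walk \<omega> i - walk \<omega> N - c)}
      \<subseteq> {\<omega>\<in>space M. \<exists>i\<le>N. stage c h j i (walk \<omega>) \<and> d + 2 * h \<le> (- 1) ^ j * (walk \<omega> N - c)}"
    proof safe
      fix \<omega> i assume i: "i \<le> N" "stage c h (Suc j) i (walk \<omega>)"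
        "d \<le> (- 1) ^ Suc j * (2 * walk \<omega> i - walk \<omega> N - c)"
      then obtain l where "l < i" "stage c h j l (walk \<omega>)" "h < (- 1) ^ j * (walk \<omega> i - c)"
        by auto
      moreover have "(- 1) ^ Suc j * (2 * walk \<omega> i - walk \<omega> N - c)
          = (- 1) ^ j * (walk \<omega> N - c) - 2 * ((- 1) ^ j * (walk \<omega> i - c))"
        by (simp add: algebra_simps)
      ultimately show "\<exists>i\<le>N. stage c h j i (walk \<omega>) \<and> d + 2 * h \<le> (- 1) ^ j * (walk \<omega> N - c)"
        using i by (intro exI[of _ l]) linarith
    qed
  qed (intro measurable_stage_event, measurable)
  also have "\<dots> \<le> prob {\<omega>\<in>space M. d + 2 * h + 2 * real j * h \<le> walk \<omega> N - c}"
    by (rule Suc.IH)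
  finally show ?case by (simp add: algebra_simps)
qed simp

text \<open>The factor 2 comes from splitting by the side of the level on which the walk ends.
  Reflecting at passage \<open>j + 1\<close>, itself beyond the level, carries ends short of the
  level to ends beyond it, so both halves have the same bound.\<close>

lemma prob_stage_le:
  "prob {\<omega>\<in>space M. \<exists>i\<le>N. stage c h (Suc j) i (walk \<omega>)}
   \<le> 2 * prob {\<omega>\<in>space M. h + 2 * real j * h \<le> walk \<omega> N - c}"
proof -
  let ?E = "\<lambda>R. {\<omega>\<in>space M. \<exists>i\<le>N. stage c h (Suc j) i (walk \<omega>) \<and> R (walk \<omega> i) (walk \<omega> N)}"
  have E: "?E R \<in> events" if [measurable]: "Measurable.pred (borel \<Otimes>\<^sub>M borel) (\<lambda>(p, q). R p q)" for R
    by (intro measurable_stage_event) measurable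
  have [measurable]: "{\<omega>\<in>space M. \<exists>i\<le>N. stage c h j i (walk \<omega>) \<and> h \<le> (- 1) ^ j * (walk \<omega> N - c)} \<in> events"
    by (intro measurable_stage_event) measurable
  have sub: "?E (\<lambda>p q. h \<le> (- 1) ^ j * (q - c))
      \<subseteq> {\<omega>\<in>space M. \<exists>i\<le>N. stage c h j i (walk \<omega>) \<and> h \<le> (- 1) ^ j * (walk \<omega> N - c)}"
  proof safe
    fix \<omega> i assume i: "i \<le> N" "stage c h (Suc j) i (walk \<omega>)" "h \<le> (- 1) ^ j * (walk \<omega> N - c)"
    then obtain l where "l < i" "stage c h j l (walk \<omega>)" by auto
    then show "\<exists>i\<le>N. stage c h j i (walk \<omega>) \<and> h \<le> (- 1) ^ j * (walk \<omega> N - c)"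
      using i by (intro exI[of _ l]) auto
  qed
  have "{\<omega>\<in>space M. \<exists>i\<le>N. stage c h (Suc j) i (walk \<omega>)}
    \<subseteq> ?E (\<lambda>p q. h \<le> (- 1) ^ j * (q - c)) \<union> ?E (\<lambda>p q. (- 1) ^ j * (q - c) < h)"
    by (auto simp del: stage.simps) (meson not_le)
  then have "prob {\<omega>\<in>space M. \<exists>i\<le>N. stage c h (Suc j) i (walk \<omega>)}
    \<le> prob (?E (\<lambda>p q. h \<le> (- 1) ^ j * (q - c)) \<union> ?E (\<lambda>p q. (- 1) ^ j * (q - c) < h))"
    by (intro finite_measure_mono sets.Un E) measurable
  also have "\<dots> \<le> prob (?E (\<lambda>p q. h \<le> (- 1) ^ j * (q - c))) + prob (?E (\<lambda>p q. (- 1) ^ j * (q - c) < h))"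
    by (intro measure_Un_le E) measurable
  also have "prob (?E (\<lambda>p q. (- 1) ^ j * (q - c) < h))
      = prob (?E (\<lambda>p q. (- 1) ^ j * (2 * p - q - c) < h))"
    by (rule prob_reflect_stage) measurable
  also have "\<dots> \<le> prob (?E (\<lambda>p q. h \<le> (- 1) ^ j * (q - c)))"
  proof (intro finite_measure_mono E)
    show "?E (\<lambda>p q. (- 1) ^ j * (2 * p - q - c) < h) \<subseteq> ?E (\<lambda>p q. h \<le> (- 1) ^ j * (q - c))"
    proof safe
      fix \<omega> i assume i: "i \<le> N" "stage c h (Suc j) i (walk \<omega>)"
        "(- 1) ^ j * (2 * walk \<omega> i - walk \<omega> N - c) < h"
      have "h < (- 1) ^ j * (walk \<omega> i - c)" using i(2) by auto
      moreover have "(- 1) ^ j * (2 * walk \<omega> i - walk \<omega> N - c)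
          = 2 * ((- 1) ^ j * (walk \<omega> i - c)) - (- 1) ^ j * (walk \<omega> N - c)"
        by (simp add: algebra_simps)
      ultimately show "\<exists>i\<le>N. stage c h (Suc j) i (walk \<omega>) \<and> h \<le> (- 1) ^ j * (walk \<omega> N - c)"
        using i by (intro exI[of _ i] conjI) linarith+
    qed
  qed measurable
  also have "prob (?E (\<lambda>p q. h \<le> (- 1) ^ j * (q - c)))
      \<le> prob {\<omega>\<in>space M. \<exists>i\<le>N. stage c h j i (walk \<omega>) \<and> h \<le> (- 1) ^ j * (walk \<omega> N - c)}"
    by (intro finite_measure_mono sub) measurable
  also have "\<dots> \<le> prob {\<omega>\<in>space M. h + 2 * real j * h \<le> walk \<omega> N - c}"
    by (rule prob_stage_end_le)
  finally show ?thesis by simp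
qed

section \<open>Lower bounds up to the overshoot\<close>

lemma prob_stage_end_overshoot:
  assumes h: "0 \<le> h" "0 \<le> c + h" and hd: "h \<le> d"
  shows "prob {\<omega>\<in>space M. \<exists>i\<le>N. stage c h j i (walk \<omega>) \<and> d < (- 1) ^ j * (walk \<omega> N - c)}
   \<le> prob {\<omega>\<in>space M. \<exists>i\<le>N. stage c h (Suc j) i (walk \<omega>) \<and>
         (- 1) ^ j * (walk \<omega> N - c) < 2 * h + 2 * \<delta> - d}
     + prob {\<omega>\<in>space M. \<exists>i<N. \<delta> < \<bar>X i \<omega>\<bar>}" (is "?l \<le> ?r + ?e")
proof -
  let ?E = "\<lambda>R. {\<omega>\<in>space M. \<exists>i\<le>N. stage c h (Suc j) i (walk \<omega>) \<and> R (walk \<omega> i) (walk \<omega> N)}"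
  have E: "?E R \<in> events" if [measurable]: "Measurable.pred (borel \<Otimes>\<^sub>M borel) (\<lambda>(p, q). R p q)" for R
    by (intro measurable_stage_event) measurable
  have X: "{\<omega>\<in>space M. \<exists>i<N. \<delta> < \<bar>X i \<omega>\<bar>} \<in> events"
  proof -
    have "{\<omega>\<in>space M. \<exists>i<N. \<delta> < \<bar>X i \<omega>\<bar>} = (\<Union>i\<in>{..<N}. {\<omega>\<in>space M. \<delta> < \<bar>X i \<omega>\<bar>})" by auto
    also have "\<dots> \<in> events" by (intro sets.finite_UN) auto
    finally show ?thesis .
  qed
  \<comment> \<open>An end beyond \<open>d \<ge> h\<close> forces passage \<open>j + 1\<close>.
    Unless some step exceeds \<delta>, that passage has signed height at most
    \<open>h + \<delta>\<close>, so mirroring there sends the end below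
    \<open>2 * (h + \<delta>) - d\<close>.\<close>
  let ?R = "\<lambda>p q. (- 1) ^ j * (p - c) \<le> h + \<delta> \<and> d < (- 1) ^ j * (q - c)"
  have "{\<omega>\<in>space M. \<exists>i\<le>N. stage c h j i (walk \<omega>) \<and> d < (- 1) ^ j * (walk \<omega> N - c)}
      \<subseteq> ?E ?R \<union> {\<omega>\<in>space M. \<exists>i<N. \<delta> < \<bar>X i \<omega>\<bar>}"
  proof
    fix \<omega> assume "\<omega> \<in> {\<omega>\<in>space M. \<exists>i\<le>N. stage c h j i (walk \<omega>) \<and> d < (- 1) ^ j * (walk \<omega> N - c)}"
    then obtain l where l: "\<omega> \<in> space M" "l \<le> N" "stage c h j l (walk \<omega>)" "d < (- 1) ^ j * (walk \<omega> N - c)"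
      by blast
    have w0: "walk \<omega> 0 \<le> c + h" using h by (simp add: walk_def)
    obtain i where i: "i \<le> N" "stage c h (Suc j) i (walk \<omega>)"
      using stage_imp_next[OF l(3), of N] l hd h w0 by auto
    obtain k where k: "i = Suc k" "(- 1) ^ j * (walk \<omega> i - c) \<le> h + \<bar>walk \<omega> i - walk \<omega> k\<bar>"
      using stage_overshoot[OF i(2) h(1) w0] by blast
    then have "(- 1) ^ j * (walk \<omega> i - c) \<le> h + \<bar>X k \<omega>\<bar>"
      by (simp add: walk_def)
    moreover have "k < N" using i k by simp
    ultimately have "(\<exists>i<N. \<delta> < \<bar>X i \<omega>\<bar>) \<or> (- 1) ^ j * (walk \<omega> i - c) \<le> h + \<delta>"
      by (metis add_left_mono not_le order_trans)
    then show "\<omega> \<in> ?E ?R \<union> {\<omega>\<in>space M. \<exists>i<N. \<delta> < \<bar>X i \<omega>\<bar>}"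
      using l i by blast
  qed
  then have "?l \<le> prob (?E ?R \<union> {\<omega>\<in>space M. \<exists>i<N. \<delta> < \<bar>X i \<omega>\<bar>})"
    by (intro finite_measure_mono sets.Un E X) measurable
  also have "\<dots> \<le> prob (?E ?R) + ?e"
    by (intro measure_Un_le E X) measurable
  also have "prob (?E ?R)
     = prob (?E (\<lambda>p q. (- 1) ^ j * (p - c) \<le> h + \<delta> \<and> d < (- 1) ^ j * (2 * p - q - c)))"
    by (rule prob_reflect_stage) measurable
  also have "\<dots> \<le> prob (?E (\<lambda>p q. (- 1) ^ j * (q - c) < 2 * h + 2 * \<delta> - d))"
  proof (intro finite_measure_mono E)
    show "?E (\<lambda>p q. (- 1) ^ j * (p - c) \<le> h + \<delta> \<and> d < (- 1) ^ j * (2 * p - q - c))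
      \<subseteq> ?E (\<lambda>p q. (- 1) ^ j * (q - c) < 2 * h + 2 * \<delta> - d)"
    proof safe
      fix \<omega> i assume i: "i \<le> N" "stage c h (Suc j) i (walk \<omega>)" "(- 1) ^ j * (walk \<omega> i - c) \<le> h + \<delta>"
        "d < (- 1) ^ j * (2 * walk \<omega> i - walk \<omega> N - c)"
      moreover have "(- 1) ^ j * (2 * walk \<omega> i - walk \<omega> N - c)
          = 2 * ((- 1) ^ j * (walk \<omega> i - c)) - (- 1) ^ j * (walk \<omega> N - c)"
        by (simp add: algebra_simps)
      ultimately show "\<exists>i\<le>N. stage c h (Suc j) i (walk \<omega>) \<and> (- 1) ^ j * (walk \<omega> N - c) < 2 * h + 2 * \<delta> - d"
        by (intro exI[of _ i] conjI) linarith+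
    qed
  qed measurable
  finally show ?thesis by simp
qed

lemma prob_stage_end_ge:
  assumes h: "0 \<le> h" "0 \<le> c + h" and \<delta>: "0 \<le> \<delta>" and "h \<le> d"
  shows "prob {\<omega>\<in>space M. d + 2 * real j * (h + \<delta>) < walk \<omega> N - c}
   \<le> prob {\<omega>\<in>space M. \<exists>i\<le>N. stage c h j i (walk \<omega>) \<and> d < (- 1) ^ j * (walk \<omega> N - c)}
     + real j * prob {\<omega>\<in>space M. \<exists>i<N. \<delta> < \<bar>X i \<omega>\<bar>}"
  using \<open>h \<le> d\<close>
proof (induction j arbitrary: d)
  case (Suc j)
  \<comment> \<open>The shift by \<open>2 * (h + \<delta>)\<close> is chosen so that the mirrored
    bound is exactly \<open>- d\<close>, that is, beyond \<open>d\<close> with the sign of the next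
    passage. Each round costs one more error probability.\<close>
  have "prob {\<omega>\<in>space M. (d + 2 * (h + \<delta>)) + 2 * real j * (h + \<delta>) < walk \<omega> N - c}
    \<le> prob {\<omega>\<in>space M. \<exists>i\<le>N. stage c h j i (walk \<omega>) \<and> d + 2 * (h + \<delta>) < (- 1) ^ j * (walk \<omega> N - c)}
      + real j * prob {\<omega>\<in>space M. \<exists>i<N. \<delta> < \<bar>X i \<omega>\<bar>}"
    using Suc.prems h \<delta> by (intro Suc.IH) auto
  also have "prob {\<omega>\<in>space M. \<exists>i\<le>N. stage c h j i (walk \<omega>) \<and> d + 2 * (h + \<delta>) < (- 1) ^ j * (walk \<omega> N - c)}
    \<le> prob {\<omega>\<in>space M. \<exists>i\<le>N. stage c h (Suc j) i (walk \<omega>) \<and>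
         (- 1) ^ j * (walk \<omega> N - c) < 2 * h + 2 * \<delta> - (d + 2 * (h + \<delta>))}
     + prob {\<omega>\<in>space M. \<exists>i<N. \<delta> < \<bar>X i \<omega>\<bar>}"
    using Suc.prems h \<delta> by (intro prob_stage_end_overshoot) auto
  also have "(\<lambda>\<omega>. (- 1) ^ j * (walk \<omega> N - c) < 2 * h + 2 * \<delta> - (d + 2 * (h + \<delta>)))
    = (\<lambda>\<omega>. d < (- 1) ^ Suc j * (walk \<omega> N - c))"
    by (auto simp: fun_eq_iff)
  finally show ?case by (simp add: algebra_simps del: stage.simps)
qed simp

text \<open>Starting from distance \<open>h + 2 * \<delta>\<close>, the mirrored end lies below
  \<open>2 * h + 2 * \<delta> - (h + 2 * \<delta>) = h\<close>, while the original one lies above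
  \<open>h\<close>. These are two disjoint ways to make passage \<open>j + 1\<close>, whence the
  factor 2. The error is counted \<open>j\<close> times in reaching passage \<open>j\<close>,
  doubled, and once more for the mirrored half.\<close>

lemma prob_stage_ge:
  assumes h: "0 \<le> h" "0 \<le> c + h" and \<delta>: "0 \<le> \<delta>"
  shows "2 * prob {\<omega>\<in>space M. h + 2 * \<delta> + 2 * real j * (h + \<delta>) < walk \<omega> N - c}
   \<le> prob {\<omega>\<in>space M. \<exists>i\<le>N. stage c h (Suc j) i (walk \<omega>)}
     + (2 * real j + 1) * prob {\<omega>\<in>space M. \<exists>i<N. \<delta> < \<bar>X i \<omega>\<bar>}"
proof -
  let ?e = "prob {\<omega>\<in>space M. \<exists>i<N. \<delta> < \<bar>X i \<omega>\<bar>}"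
  let ?g = "prob {\<omega>\<in>space M. h + 2 * \<delta> + 2 * real j * (h + \<delta>) < walk \<omega> N - c}"
  let ?L = "\<lambda>d. {\<omega>\<in>space M. \<exists>i\<le>N. stage c h j i (walk \<omega>) \<and> d < (- 1) ^ j * (walk \<omega> N - c)}"
  let ?E = "\<lambda>R. {\<omega>\<in>space M. \<exists>i\<le>N. stage c h (Suc j) i (walk \<omega>) \<and> R (walk \<omega> N)}"
  have E: "?E R \<in> events" if [measurable]: "Measurable.pred borel R" for R
    by (intro measurable_stage_event) measurable
  have g: "?g \<le> prob (?L (h + 2 * \<delta>)) + real j * ?e"
    using h \<delta> by (intro prob_stage_end_ge) auto
  have "prob (?L (h + 2 * \<delta>)) \<le> prob (?E (\<lambda>q. h < (- 1) ^ j * (q - c)))"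
  proof (intro finite_measure_mono E)
    show "?L (h + 2 * \<delta>) \<subseteq> ?E (\<lambda>q. h < (- 1) ^ j * (q - c))"
    proof
      fix \<omega> assume "\<omega> \<in> ?L (h + 2 * \<delta>)"
      then obtain l where l: "\<omega> \<in> space M" "l \<le> N" "stage c h j l (walk \<omega>)"
          "h + 2 * \<delta> < (- 1) ^ j * (walk \<omega> N - c)"
        by blast
      then have "h < (- 1) ^ j * (walk \<omega> N - c)" using \<delta> by linarith
      moreover have "walk \<omega> 0 \<le> c + h" using h by (simp add: walk_def)
      ultimately have "\<exists>i\<le>N. stage c h (Suc j) i (walk \<omega>)" "h < (- 1) ^ j * (walk \<omega> N - c)"
        using stage_imp_next[OF l(3) _ l(2) h(1)] by blast+
      then show "\<omega> \<in> ?E (\<lambda>q. h < (- 1) ^ j * (q - c))"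
        using l(1) by blast
    qed
  qed measurable
  moreover have "prob (?L (h + 2 * \<delta>))
     \<le> prob (?E (\<lambda>q. (- 1) ^ j * (q - c) < 2 * h + 2 * \<delta> - (h + 2 * \<delta>))) + ?e"
    using h \<delta> by (intro prob_stage_end_overshoot) auto
  then have "prob (?L (h + 2 * \<delta>)) \<le> prob (?E (\<lambda>q. (- 1) ^ j * (q - c) < h)) + ?e"
    by simp
  moreover have "prob (?E (\<lambda>q. h < (- 1) ^ j * (q - c))) + prob (?E (\<lambda>q. (- 1) ^ j * (q - c) < h))
      \<le> prob {\<omega>\<in>space M. \<exists>i\<le>N. stage c h (Suc j) i (walk \<omega>)}"
  proof -
    have "{\<omega>\<in>space M. \<exists>i\<le>N. stage c h (Suc j) i (walk \<omega>)} \<in> events"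
      using E[of "\<lambda>_. True"] by simp
    moreover have "?E (\<lambda>q. h < (- 1) ^ j * (q - c)) \<union> ?E (\<lambda>q. (- 1) ^ j * (q - c) < h)
        \<subseteq> {\<omega>\<in>space M. \<exists>i\<le>N. stage c h (Suc j) i (walk \<omega>)}" by blast
    ultimately have "prob (?E (\<lambda>q. h < (- 1) ^ j * (q - c)) \<union> ?E (\<lambda>q. (- 1) ^ j * (q - c) < h))
        \<le> prob {\<omega>\<in>space M. \<exists>i\<le>N. stage c h (Suc j) i (walk \<omega>)}"
      by (rule finite_measure_mono[rotated])
    moreover have "prob (?E (\<lambda>q. h < (- 1) ^ j * (q - c)) \<union> ?E (\<lambda>q. (- 1) ^ j * (q - c) < h))
        = prob (?E (\<lambda>q. h < (- 1) ^ j * (q - c))) + prob (?E (\<lambda>q. (- 1) ^ j * (q - c) < h))"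
    proof (intro finite_measure_Union E)
      show "?E (\<lambda>q. h < (- 1) ^ j * (q - c)) \<inter> ?E (\<lambda>q. (- 1) ^ j * (q - c) < h) = {}"
        by (auto simp del: stage.simps)
    qed measurable
    ultimately show ?thesis by linarith
  qed
  ultimately have "2 * prob (?L (h + 2 * \<delta>)) \<le> prob {\<omega>\<in>space M. \<exists>i\<le>N. stage c h (Suc j) i (walk \<omega>)} + ?e"
    by linarith
  with g show ?thesis by (simp add: algebra_simps del: stage.simps)
qed

end

section \<open>Bars and alternating passages\<close>

lemma of_nat_le_emeasure_count_space_iff:
  "of_nat n \<le> emeasure (count_space UNIV) A \<longleftrightarrow> (\<exists>F\<subseteq>A. finite F \<and> card F = n)"
proof (cases "finite A")
  case True
  have "of_nat n \<le> emeasure (count_space UNIV) A \<longleftrightarrow> n \<le> card A"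
    using True by (simp add: emeasure_count_space)
  also have "\<dots> \<longleftrightarrow> (\<exists>F\<subseteq>A. finite F \<and> card F = n)"
    using True by (metis card_mono obtain_subset_with_card_n)
  finally show ?thesis .
next
  case False
  then show ?thesis
    using infinite_arbitrarily_large[OF False, of n] by (auto simp: emeasure_count_space)
qed

text \<open>The tail-sum formula for a cardinality, valid also for an infinite one. After
  integration it turns the expected count into a series of probabilities of having at least
  \<open>n + 1\<close> bars.\<close>

lemma emeasure_count_space_eq_suminf:
  "emeasure (count_space UNIV) A
    = (\<Sum>n. indicator {n. of_nat (Suc n) \<le> emeasure (count_space UNIV) A} n)"
proof -
  have "(\<Sum>n. indicator S n :: ennreal) = emeasure (count_space UNIV) S" for S :: "nat set"
    using nn_integral_count_space_nat[of "indicator S"] by simp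
  moreover have "emeasure (count_space UNIV) {n. of_nat (Suc n) \<le> emeasure (count_space UNIV) A}
      = emeasure (count_space UNIV) A"
  proof (cases "finite A")
    case True
    have "(of_nat (Suc n) \<le> (of_nat (card A) :: ennreal)) \<longleftrightarrow> n < card A" for n
      unfolding of_nat_le_iff by auto
    then have "{n. of_nat (Suc n) \<le> emeasure (count_space UNIV) A} = {..<card A}"
      using True by (auto simp: emeasure_count_space simp del: of_nat_Suc)
    with True show ?thesis by (simp add: emeasure_count_space)
  next
    case False
    then show ?thesis by (simp add: emeasure_count_space)
  qed
  ultimately show ?thesis by simp
qed

text \<open>The odd times lie in bars, and different odd times in different ones: a component is an
  interval, so a common one would contain the even time in between, where \<open>f\<close> is at
  most \<open>x\<close>.\<close>

lemma chain_imp_bar_count_ge: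
  fixes f :: "real \<Rightarrow> real"
  assumes s: "0 \<le> s 0" "s (Suc (2 * n)) \<le> t" "\<And>k. k \<le> 2 * n \<Longrightarrow> s k < s (Suc k)"
    and up: "\<And>k. k \<le> n \<Longrightarrow> y \<le> f (s (Suc (2 * k)))"
    and down: "\<And>k. k < n \<Longrightarrow> f (s (Suc (Suc (2 * k)))) \<le> x"
    and "x < y"
  shows "of_nat (Suc n) \<le> bar_count f t x y"
proof -
  let ?U = "{u \<in> {0..t}. x < f u}"
  let ?C = "\<lambda>k. connected_component_set ?U (s (Suc (2 * k)))"
  have mono: "s k \<le> s l" if "k \<le> l" "l \<le> Suc (2 * n)" for k l
    using that
  proof (induction l rule: dec_induct)
    case (step l)
    then show ?case using s(3)[of l] by simp
  qed simp
  have in_U: "s (Suc (2 * k)) \<in> ?U" if "k \<le> n" for k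
  proof -
    have "s 0 \<le> s (Suc (2 * k))" "s (Suc (2 * k)) \<le> s (Suc (2 * n))"
      using that by (intro mono; simp)+
    then show ?thesis
      using s(1,2) up[OF that] \<open>x < y\<close> by simp
  qed
  have neq: "?C k \<noteq> ?C l" if "k < l" "l \<le> n" for k l
  proof
    assume eq: "?C k = ?C l"
    have k: "s (Suc (2 * k)) \<in> ?C k"
      using in_U[of k] that by (subst mem_Collect_eq, intro connected_component_refl) simp
    have "s (Suc (2 * l)) \<in> ?C l"
      using in_U[of l] that by (subst mem_Collect_eq, intro connected_component_refl) simp
    then have l: "s (Suc (2 * l)) \<in> ?C k"
      unfolding eq .
    have "s (Suc (2 * k)) \<le> s (Suc (Suc (2 * k)))" "s (Suc (Suc (2 * k))) \<le> s (Suc (2 * l))"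
      using that by (intro mono; simp)+
    then have "s (Suc (Suc (2 * k))) \<in> ?C k"
      using k l by (intro mem_is_interval_1_I[OF _ k l]) (simp_all add: is_interval_connected_1)
    then have "s (Suc (Suc (2 * k))) \<in> ?U"
      by (rule subsetD[OF connected_component_subset])
    then show False
      using down[of k] that by simp
  qed
  have "inj_on ?C {..n}"
  proof (rule inj_onI)
    fix k l assume "k \<in> {..n}" "l \<in> {..n}" "?C k = ?C l"
    then show "k = l"
      using neq[of k l] neq[of l k] by (cases k l rule: linorder_cases) auto
  qed
  then have "card (?C ` {..n}) = Suc n"
    by (simp add: card_image)
  moreover have "?C ` {..n} \<subseteq> {C \<in> components ?U. \<exists>u\<in>C. y \<le> f u}"
  proof (rule image_subsetI)
    fix k assume "k \<in> {..n}"
    then have "?C k \<in> components ?U" "y \<le> f (s (Suc (2 * k)))"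
      using in_U[of k] up[of k] unfolding components_def by blast+
    moreover have "s (Suc (2 * k)) \<in> ?C k"
      using in_U[of k] \<open>k \<in> {..n}\<close> by (subst mem_Collect_eq, intro connected_component_refl) simp
    ultimately show "?C k \<in> {C \<in> components ?U. \<exists>u\<in>C. y \<le> f u}" by blast
  qed
  ultimately have "\<exists>F\<subseteq>{C \<in> components ?U. \<exists>u\<in>C. y \<le> f u}. finite F \<and> card F = Suc n"
    by (intro exI[of _ "?C ` {..n}"] conjI finite_imageI finite_atMost)
  then show ?thesis
    unfolding bar_count_def of_nat_le_emeasure_count_space_iff .
qed

text \<open>Choose a point at height \<open>y\<close> in each of \<open>n + 1\<close> bars and sort
  these points. Between neighbours \<open>f\<close> must fall to \<open>x\<close>, since otherwise
  the interval joining them would lie in a single component.\<close>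

lemma bar_count_ge_imp_chain:
  fixes f :: "real \<Rightarrow> real"
  assumes "of_nat (Suc n) \<le> bar_count f t x y" "f 0 \<le> x" "x < y"
  shows "\<exists>s. s 0 = 0 \<and> s (Suc (2 * n)) \<le> t \<and> (\<forall>k\<le>2 * n. s k < s (Suc k)) \<and>
    (\<forall>k\<le>n. y \<le> f (s (Suc (2 * k)))) \<and> (\<forall>k<n. f (s (Suc (Suc (2 * k)))) \<le> x)"
proof -
  let ?U = "{u \<in> {0..t}. x < f u}"
  obtain F where F: "F \<subseteq> {C \<in> components ?U. \<exists>u\<in>C. y \<le> f u}" "finite F" "card F = Suc n"
    using assms(1) unfolding bar_count_def of_nat_le_emeasure_count_space_iff by blast
  then have "\<forall>C\<in>F. \<exists>u. u \<in> C \<and> y \<le> f u" by blast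
  then obtain p where p: "\<And>C. C \<in> F \<Longrightarrow> p C \<in> C" "\<And>C. C \<in> F \<Longrightarrow> y \<le> f (p C)"
    by metis
  have FU: "C \<in> components ?U" if "C \<in> F" for C using F(1) that by blast
  have inj: "inj_on p F"
  proof (rule inj_onI)
    fix C D assume "C \<in> F" "D \<in> F" "p C = p D"
    then have "C \<inter> D \<noteq> {}" using p(1)[of C] p(1)[of D] by auto
    then show "C = D" using components_eq[OF FU FU, of C D] \<open>C \<in> F\<close> \<open>D \<in> F\<close> by blast
  qed
  define v where "v = (!) (sorted_list_of_set (p ` F))"
  have len: "length (sorted_list_of_set (p ` F)) = Suc n"
    using inj F by (simp add: card_image)
  have v_less: "v k < v (Suc k)" if "k < n" for k
    using sorted_wrt_nth_less[OF strict_sorted_list_of_set, of k "Suc k" "p ` F"] that len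
    by (simp add: v_def)
  have v_mem: "v k \<in> p ` F" if "k \<le> n" for k
    using nth_mem[of k "sorted_list_of_set (p ` F)"] that len F(2) by (simp add: v_def)
  have v: "v k \<in> ?U" "y \<le> f (v k)" if k: "k \<le> n" for k
  proof -
    obtain C where C: "C \<in> F" "v k = p C" using v_mem[OF k] by blast
    show "v k \<in> ?U"
      using in_components_subset[OF FU[OF C(1)]] p(1)[OF C(1)] C(2) by (simp only: subsetD)
    show "y \<le> f (v k)"
      using p(2)[OF C(1)] C(2) by simp
  qed
  have "\<exists>r. v k < r \<and> r < v (Suc k) \<and> f r \<le> x" if kn: "k < n" for k
  proof (rule ccontr)
    assume *: "\<not> ?thesis"
    obtain C D where CD: "C \<in> F" "v k = p C" "D \<in> F" "v (Suc k) = p D"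
      using v_mem[of k] v_mem[of "Suc k"] kn by auto
    have "{v k..v (Suc k)} \<subseteq> ?U"
    proof
      fix r assume r: "r \<in> {v k..v (Suc k)}"
      have "x < f r"
      proof (cases "r = v k \<or> r = v (Suc k)")
        case True
        then show ?thesis using v(1)[of k] v(1)[of "Suc k"] that by auto
      next
        case False
        then have "v k < r" "r < v (Suc k)" using r by auto
        then show ?thesis using * by (meson not_le)
      qed
      then show "r \<in> ?U"
        using r v(1)[of k] v(1)[of "Suc k"] that by auto
    qed
    moreover have "connected {v k..v (Suc k)}" by simp
    moreover have "v k \<in> C"
      using CD p(1) by metis
    then have "C \<inter> {v k..v (Suc k)} \<noteq> {}"
      using v_less[OF that] by (auto intro!: exI[of _ "v k"])
    ultimately have "{v k..v (Suc k)} \<subseteq> C"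
      using components_maximal[OF FU[OF CD(1)]] by blast
    moreover have "v (Suc k) \<in> {v k..v (Suc k)}"
      using v_less[OF that] by simp
    moreover have "v (Suc k) \<in> D"
      using CD p(1) by metis
    ultimately have "C \<inter> D \<noteq> {}" by blast
    then have "C = D"
      using components_eq[OF FU[OF CD(1)] FU[OF CD(3)]] by blast
    then show False using CD v_less[OF that] by simp
  qed
  then obtain r where r: "\<And>k. k < n \<Longrightarrow> v k < r k \<and> r k < v (Suc k) \<and> f (r k) \<le> x"
    by metis
  \<comment> \<open>Interleaving: odd indices are the chosen high points, positive even indices the
    low points between them. The start \<open>0\<close> strictly precedes the first high point
    because \<open>f 0 \<le> x < y\<close>.\<close>
  define s where "s i = (if i = 0 then 0 else if odd i then v (i div 2) else r (i div 2 - 1))" for i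
  have s_odd: "s (Suc (2 * k)) = v k" and s_even: "s (Suc (Suc (2 * k))) = r k" for k
    by (simp_all add: s_def)
  have v0: "0 < v 0"
  proof -
    have "v 0 \<noteq> 0" using v(2)[of 0] assms(2,3) by auto
    then show ?thesis using v(1)[of 0] by simp
  qed
  have "s k < s (Suc k)" if "k \<le> 2 * n" for k
  proof (cases "even k")
    case False
    then obtain l where "k = Suc (2 * l)" by (metis oddE Suc_eq_plus1)
    then show ?thesis using r[of l] that s_odd s_even by simp
  next
    case True
    then obtain l where l: "k = 2 * l" by auto
    show ?thesis
    proof (cases l)
      case 0
      then show ?thesis using l s_odd[of 0] v0 by (simp add: s_def)
    next
      case (Suc l')
      then have "k = Suc (Suc (2 * l'))" using l by simp
      then show ?thesis
        using r[of l'] that s_odd[of "Suc l'"] s_even[of l'] by simp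
    qed
  qed
  moreover have "s 0 = 0" by (simp add: s_def)
  moreover have "s (Suc (2 * n)) \<le> t"
    using v(1)[of n] by (simp add: s_odd)
  moreover have "y \<le> f (s (Suc (2 * k)))" if "k \<le> n" for k
    using v(2)[OF that] by (simp only: s_odd)
  moreover have "f (s (Suc (Suc (2 * k)))) \<le> x" if "k < n" for k
    using r[OF that] by (simp only: s_even)
  ultimately show ?thesis by blast
qed

text \<open>A chain consists of finitely many strict inequalities between times and between values.
  By continuity they persist once the times are replaced by sufficiently close grid times.\<close>

lemma dyadic_chain:
  fixes f :: "real \<Rightarrow> real"
  assumes cont: "continuous_on {0..t} f" and t: "0 < t"
    and s: "s 0 = 0" "s j \<le> t" "\<And>k. k < j \<Longrightarrow> s k < s (Suc k) \<and> h < (- 1) ^ k * (f (s (Suc k)) - c)"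
  shows "\<exists>m. \<exists>\<sigma>::nat \<Rightarrow> nat. \<sigma> 0 = 0 \<and> \<sigma> j \<le> 2 ^ m \<and>
    (\<forall>k<j. \<sigma> k < \<sigma> (Suc k) \<and> h < (- 1) ^ k * (f (real (\<sigma> (Suc k)) * (t / 2 ^ m)) - c))"
proof -
  \<comment> \<open>Rounding down keeps the grid times inside \<open>{0..t}\<close>, where
    \<open>f\<close> is known to be continuous, and fixes the starting time
    \<open>0\<close>.\<close>
  define \<sigma> where "\<sigma> m k = nat \<lfloor>s k / (t / 2 ^ m)\<rfloor>" for m k :: nat
  define a where "a m k = real (\<sigma> m k) * (t / 2 ^ m)" for m k :: nat
  have mono: "s k \<le> s l" if "k \<le> l" "l \<le> j" for k l
    using that
  proof (induction l rule: dec_induct)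
    case (step l)
    then show ?case using s(3)[of l] by simp
  qed simp
  have s_range: "0 \<le> s k" "s k \<le> t" if "k \<le> j" for k
    using mono[of 0 k] mono[of k j] s(1,2) that by auto
  have a_bounds: "s k - t / 2 ^ m \<le> a m k \<and> a m k \<le> s k" if "k \<le> j" for m k
  proof -
    have "0 \<le> s k / (t / 2 ^ m)" using s_range[OF that] t by simp
    then have "s k / (t / 2 ^ m) \<le> real (\<sigma> m k) + 1" "real (\<sigma> m k) \<le> s k / (t / 2 ^ m)"
      unfolding \<sigma>_def by linarith+
    moreover have "0 < t / 2 ^ m" using t by simp
    ultimately have "s k \<le> (real (\<sigma> m k) + 1) * (t / 2 ^ m)" "real (\<sigma> m k) * (t / 2 ^ m) \<le> s k"
      by (simp_all only: pos_divide_le_eq pos_le_divide_eq)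
    then show ?thesis
      unfolding a_def distrib_right by simp
  qed
  have "(\<lambda>m. t * (1 / 2) ^ m) \<longlonglongrightarrow> t * 0"
    by (intro tendsto_mult tendsto_const LIMSEQ_realpow_zero) simp_all
  then have "(\<lambda>m. t / 2 ^ m) \<longlonglongrightarrow> 0"
    by (simp add: power_one_over)
  then have "(\<lambda>m. s k - t / 2 ^ m) \<longlonglongrightarrow> s k - 0" for k
    by (intro tendsto_diff tendsto_const)
  then have s_lim: "(\<lambda>m. s k - t / 2 ^ m) \<longlonglongrightarrow> s k" for k
    by simp
  have a_lim: "(\<lambda>m. a m k) \<longlonglongrightarrow> s k" if "k \<le> j" for k
    by (rule real_tendsto_sandwich[OF _ _ s_lim tendsto_const]) (use a_bounds[OF that] in simp_all)
  have a_range: "a m k \<in> {0..t}" if "k \<le> j" for m k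
    using a_bounds[OF that, of m] s_range[OF that] t by (auto simp: a_def)
  have "eventually (\<lambda>m. a m k < a m (Suc k) \<and> h < (- 1) ^ k * (f (a m (Suc k)) - c)) sequentially"
    if "k < j" for k
  proof (rule eventually_conj)
    show "eventually (\<lambda>m. a m k < a m (Suc k)) sequentially"
    proof -
      have "(\<lambda>m. a m (Suc k) - a m k) \<longlonglongrightarrow> s (Suc k) - s k"
        using that by (intro tendsto_diff a_lim) auto
      then have "eventually (\<lambda>m. 0 < a m (Suc k) - a m k) sequentially"
        using s(3)[OF that] by (intro order_tendstoD(1)) auto
      then show ?thesis by simp
    qed
    have "(\<lambda>m. f (a m (Suc k))) \<longlonglongrightarrow> f (s (Suc k))"
      using that a_range[of "Suc k"] s_range[of "Suc k"]
      by (intro continuous_on_tendsto_compose[OF cont a_lim] always_eventually) simp_all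
    then have "(\<lambda>m. (- 1) ^ k * (f (a m (Suc k)) - c)) \<longlonglongrightarrow> (- 1) ^ k * (f (s (Suc k)) - c)"
      by (intro tendsto_intros)
    then show "eventually (\<lambda>m. h < (- 1) ^ k * (f (a m (Suc k)) - c)) sequentially"
      using s(3)[OF that] by (intro order_tendstoD(1)) auto
  qed
  then have "eventually (\<lambda>m. \<forall>k\<in>{..<j}. a m k < a m (Suc k) \<and> h < (- 1) ^ k * (f (a m (Suc k)) - c)) sequentially"
    by (intro eventually_ball_finite) auto
  then obtain m where m: "\<And>k. k < j \<Longrightarrow> a m k < a m (Suc k) \<and> h < (- 1) ^ k * (f (a m (Suc k)) - c)"
    using eventually_happens'[OF sequentially_bot] by (metis (no_types, lifting) lessThan_iff)
  have "\<sigma> m k < \<sigma> m (Suc k)" if "k < j" for k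
    using m[OF that] t mult_less_cancel_right_pos[of "t / 2 ^ m" "real (\<sigma> m k)" "real (\<sigma> m (Suc k))"]
    unfolding a_def by simp
  moreover have "\<sigma> m j \<le> 2 ^ m"
  proof -
    have "real (\<sigma> m j) * t \<le> 2 ^ m * t"
      using a_range[of j m] by (simp add: a_def pos_divide_le_eq mult.commute)
    then have "real (\<sigma> m j) \<le> real (2 ^ m)"
      using t by simp
    then show ?thesis by (simp only: of_nat_le_iff)
  qed
  moreover have "\<sigma> m 0 = 0"
    by (simp add: \<sigma>_def s)
  ultimately show ?thesis
    using m unfolding a_def by blast
qed

section \<open>Bars of the absolute value\<close>

lemma components_subset_components_Un:
  assumes dich: "\<And>D. connected D \<Longrightarrow> D \<subseteq> U \<union> V \<Longrightarrow> D \<subseteq> U \<or> D \<subseteq> V" and "U \<inter> V = {}"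
  shows "components U \<subseteq> components (U \<union> V)"
proof
  fix C assume C: "C \<in> components U"
  then have "C \<noteq> {}" "C \<subseteq> U" "connected C"
    by (simp_all add: in_components_maximal)
  moreover have "d = C" if d: "d \<noteq> {}" "C \<subseteq> d" "d \<subseteq> U \<union> V" "connected d" for d
  proof -
    have "d \<subseteq> U"
      using dich[OF d(4,3)] d(2) \<open>C \<noteq> {}\<close> \<open>C \<subseteq> U\<close> assms(2) by blast
    then show ?thesis
      using C d(1,2,4) by (simp add: in_components_maximal)
  qed
  ultimately show "C \<in> components (U \<union> V)"
    by (auto simp: in_components_maximal)
qed

text \<open>Two disjoint relatively open parts separate their union, so every connected subset lies
  in one of them and no components merge.\<close>

lemma components_Un_openin:
  fixes U V :: "'a::topological_space set"
  assumes "openin (top_of_set (U \<union> V)) U" "openin (top_of_set (U \<union> V)) V" "U \<inter> V = {}"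
  shows "components (U \<union> V) = components U \<union> components V"
proof
  obtain S where S: "open S" "U = (U \<union> V) \<inter> S"
    using assms(1) by (meson openin_open)
  obtain T where T: "open T" "V = (U \<union> V) \<inter> T"
    using assms(2) by (meson openin_open)
  have dich: "D \<subseteq> U \<or> D \<subseteq> V" if "connected D" "D \<subseteq> U \<union> V" for D
  proof -
    have "S \<inter> T \<inter> D = {}" "D \<subseteq> S \<union> T"
      using S(2) T(2) assms(3) that(2) by blast+
    then have "S \<inter> D = {} \<or> T \<inter> D = {}"
      using connectedD[OF that(1) S(1) T(1)] by blast
    then show ?thesis
      using S(2) T(2) that(2) by blast
  qed
  show "components (U \<union> V) \<subseteq> components U \<union> components V"
  proof
    fix C assume C: "C \<in> components (U \<union> V)"
    then have "connected C" "C \<subseteq> U \<union> V"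
      by (simp_all add: in_components_maximal)
    from dich[OF this] C show "C \<in> components U \<union> components V"
      by (auto simp: in_components_maximal le_supI1 le_supI2)
  qed
  show "components U \<union> components V \<subseteq> components (U \<union> V)"
    using components_subset_components_Un[of U V] components_subset_components_Un[of V U] dich assms(3)
    by (simp add: Un_commute Int_commute disj_commute)
qed

text \<open>\<open>0 \<le> x\<close> makes the parts above \<open>x\<close> and below
  \<open>- x\<close> disjoint, and continuity makes both relatively open. A jump from one to the
  other could fuse two bars into one.\<close>

lemma bar_count_abs:
  assumes cont: "continuous_on {0..t} f" and "0 \<le> x"
  shows "bar_count (\<lambda>u. \<bar>f u\<bar>) t x y = bar_count f t x y + bar_count (\<lambda>u. - f u) t x y"
proof -
  let ?U = "{u \<in> {0..t}. x < f u}" and ?V = "{u \<in> {0..t}. x < - f u}"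
  have UV: "{u \<in> {0..t}. x < \<bar>f u\<bar>} = ?U \<union> ?V"
    by auto
  have op: "openin (top_of_set (?U \<union> ?V)) ({0..t} \<inter> g -` {x<..})"
    if "continuous_on {0..t} g" "{0..t} \<inter> g -` {x<..} \<subseteq> ?U \<union> ?V" for g
    using continuous_openin_preimage_gen[OF that(1), of "{x<..}"] that(2)
    by (rule_tac openin_subset_trans[of "{0..t}"]) auto
  have "openin (top_of_set (?U \<union> ?V)) ?U" "openin (top_of_set (?U \<union> ?V)) ?V"
    using op[OF cont] op[OF continuous_on_minus[OF cont]]
    by (auto simp: vimage_def Int_def)
  moreover have disj: "?U \<inter> ?V = {}" using \<open>0 \<le> x\<close> by auto
  ultimately have comp: "components (?U \<union> ?V) = components ?U \<union> components ?V"
    by (rule components_Un_openin)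
  let ?A = "{C \<in> components ?U. \<exists>u\<in>C. y \<le> f u}" and ?B = "{C \<in> components ?V. \<exists>u\<in>C. y \<le> - f u}"
  have U: "\<bar>f u\<bar> = f u" if "C \<in> components ?U" "u \<in> C" for C u
    using in_components_subset[OF that(1)] that(2) \<open>0 \<le> x\<close> by auto
  have V: "\<bar>f u\<bar> = - f u" if "C \<in> components ?V" "u \<in> C" for C u
    using in_components_subset[OF that(1)] that(2) \<open>0 \<le> x\<close> by auto
  have "{C \<in> components (?U \<union> ?V). \<exists>u\<in>C. y \<le> \<bar>f u\<bar>} = ?A \<union> ?B"
    unfolding comp using U V by force
  moreover have "?A \<inter> ?B = {}"
    using disj in_components_subset in_components_nonempty by blast
  ultimately show ?thesis
    unfolding bar_count_def UV by (simp add: plus_emeasure)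
qed

section \<open>Gaussian tails\<close>

lemma erfc_nonneg: "0 \<le> erfc z"
  unfolding erfc_def set_lebesgue_integral_def by (auto intro!: mult_nonneg_nonneg integral_nonneg)

lemma (in prob_space) prob_eq_0_normal:
  assumes Z: "distributed M lborel Z (normal_density \<mu> \<sigma>)"
  shows "prob {\<omega>\<in>space M. Z \<omega> = a} = 0"
proof -
  have "emeasure M (Z -` {a} \<inter> space M)
      = (\<integral>\<^sup>+x. ennreal (normal_density \<mu> \<sigma> x) * indicator {a} x \<partial>lborel)"
    using Z by (rule distributed_emeasure) simp
  also have "\<dots> = (\<integral>\<^sup>+x. 0 \<partial>(lborel :: real measure))"
    using AE_lborel_singleton[of a] by (intro nn_integral_cong_AE) (auto elim!: eventually_mono)
  finally have "emeasure M (Z -` {a} \<inter> space M) = 0" by simp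
  moreover have "Z -` {a} \<inter> space M = {\<omega>\<in>space M. Z \<omega> = a}" by auto
  ultimately show ?thesis by (simp add: measure_def)
qed

lemma (in prob_space) prob_ge_eq_greater_normal:
  assumes Z: "distributed M lborel Z (normal_density \<mu> \<sigma>)"
  shows "prob {\<omega>\<in>space M. a \<le> Z \<omega>} = prob {\<omega>\<in>space M. a < Z \<omega>}"
proof -
  have [measurable]: "Z \<in> borel_measurable M"
    using distributed_measurable[OF Z] by simp
  have "{\<omega>\<in>space M. a \<le> Z \<omega>} = {\<omega>\<in>space M. a < Z \<omega>} \<union> {\<omega>\<in>space M. Z \<omega> = a}" by auto
  then have "prob {\<omega>\<in>space M. a \<le> Z \<omega>} = prob {\<omega>\<in>space M. a < Z \<omega>} + prob {\<omega>\<in>space M. Z \<omega> = a}"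
    by (simp only:) (rule finite_measure_Union, auto)
  then show ?thesis
    using prob_eq_0_normal[OF Z] by simp
qed

text \<open>A Gaussian law has no atoms. This continuity is what lets first the overshoot \<delta>
  tend to \<open>0\<close> and later the half width tend to \<open>h\<close>.\<close>

lemma (in prob_space) isCont_normal_tail:
  assumes Z: "distributed M lborel Z (normal_density \<mu> \<sigma>)"
  shows "isCont (\<lambda>a. prob {\<omega>\<in>space M. a < Z \<omega>}) a"
proof -
  have [measurable]: "Z \<in> borel_measurable M"
    using distributed_measurable[OF Z] by simp
  interpret D: real_distribution "distr M borel Z" by simp
  interpret D: finite_borel_measure "distr M borel Z" by (rule D.finite_borel_measure_M)
  have "measure (distr M borel Z) {a} = prob (Z -` {a} \<inter> space M)"
    by (intro measure_distr) auto
  also have "Z -` {a} \<inter> space M = {\<omega>\<in>space M. Z \<omega> = a}" by auto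
  finally have "isCont (cdf (distr M borel Z)) a"
    using prob_eq_0_normal[OF Z] by (simp add: D.isCont_cdf)
  moreover have "prob {\<omega>\<in>space M. a < Z \<omega>} = 1 - cdf (distr M borel Z) a" for a
  proof -
    have "cdf (distr M borel Z) a = prob (Z -` {..a} \<inter> space M)"
      unfolding cdf_def by (intro measure_distr) auto
    also have "Z -` {..a} \<inter> space M = {\<omega>\<in>space M. \<not> a < Z \<omega>}" by auto
    also have "prob \<dots> = 1 - prob {\<omega>\<in>space M. a < Z \<omega>}"
      by (rule prob_neg) measurable
    finally show ?thesis by simp
  qed
  ultimately show ?thesis by simp
qed

lemma (in prob_space) normal_tail_erfc:
  assumes Z: "distributed M lborel Z (normal_density 0 (sqrt t))" and t: "0 < t"
  shows "prob {\<omega>\<in>space M. a < Z \<omega>} = erfc (a / sqrt (2 * t)) / 2"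
proof -
  let ?z = "a / sqrt (2 * t)" and ?r = "sqrt (2 * t)"
  have r: "0 < ?r" using t by simp
  \<comment> \<open>Scaling by \<open>sqrt (2 * t)\<close> gives standard deviation
    \<open>1 / sqrt 2\<close>, for which the normal density is half the integrand of
    \<open>erfc\<close> including its prefactor.\<close>
  have dens: "normal_density 0 (1 / sqrt 2) x = exp (- x\<^sup>2) / sqrt pi" for x
    by (simp add: normal_density_def power_divide)
  have "distributed M lborel (\<lambda>\<omega>. 0 + 1 / ?r * Z \<omega>) (normal_density (0 + 1 / ?r * 0) (\<bar>1 / ?r\<bar> * sqrt t))"
    using t by (intro normal_density_affine[OF Z]) auto
  moreover have "\<bar>1 / ?r\<bar> * sqrt t = 1 / sqrt 2"
    using t by (simp add: real_sqrt_mult)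
  ultimately have D: "distributed M lborel (\<lambda>\<omega>. Z \<omega> / ?r) (normal_density 0 (1 / sqrt 2))"
    by (simp only: add_0 mult_zero_right) (simp add: divide_inverse mult.commute)
  have "prob {\<omega>\<in>space M. a < Z \<omega>} = prob {\<omega>\<in>space M. a \<le> Z \<omega>}"
    using prob_ge_eq_greater_normal[OF Z] by simp
  also have "{\<omega>\<in>space M. a \<le> Z \<omega>} = (\<lambda>\<omega>. Z \<omega> / ?r) -` {?z..} \<inter> space M"
    using r by (auto simp: divide_le_cancel)
  also have "prob \<dots> = (\<integral>\<omega>. indicator {?z..} (Z \<omega> / ?r) \<partial>M)"
  proof -
    have [measurable]: "(\<lambda>\<omega>. Z \<omega> / ?r) \<in> borel_measurable M"
      using distributed_measurable[OF D] by simp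
    have "(\<integral>\<omega>. indicator {?z..} (Z \<omega> / ?r) \<partial>M)
        = (\<integral>\<omega>. indicator ((\<lambda>\<omega>. Z \<omega> / ?r) -` {?z..} \<inter> space M) \<omega> \<partial>M)"
      by (intro Bochner_Integration.integral_cong) (auto simp: indicator_def)
    also have "\<dots> = prob ((\<lambda>\<omega>. Z \<omega> / ?r) -` {?z..} \<inter> space M)"
      by simp
    finally show ?thesis by simp
  qed
  also have "\<dots> = (\<integral>x. normal_density 0 (1 / sqrt 2) x * indicator {?z..} x \<partial>lborel)"
    using distributed_integral[OF D, of "indicator {?z..}"] by simp
  also have "\<dots> = (\<integral>x. (1 / sqrt pi) * (indicator {?z..} x *\<^sub>R exp (- x\<^sup>2)) \<partial>lborel)"
    by (intro Bochner_Integration.integral_cong refl) (simp add: dens)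
  also have "\<dots> = (1 / sqrt pi) * (LINT x:{?z..}|lborel. exp (- x\<^sup>2))"
    unfolding set_lebesgue_integral_def by simp
  finally show ?thesis by (simp add: erfc_def)
qed

text \<open>Markov's inequality for the fourth power. The second moment would be too weak:
  \<open>2 ^ m\<close> increments of variance \<open>t / 2 ^ m\<close> yield a union bound that does
  not tend to \<open>0\<close>.\<close>

lemma (in prob_space) prob_normal_fourth_moment:
  assumes Z: "distributed M lborel Z (normal_density 0 \<sigma>)" and "0 < \<sigma>" "0 < \<delta>"
  shows "prob {\<omega>\<in>space M. \<delta> < \<bar>Z \<omega>\<bar>} \<le> 3 * \<sigma> ^ 4 / \<delta> ^ 4"
proof -
  have [measurable]: "Z \<in> borel_measurable M"
    using distributed_measurable[OF Z] by simp
  have m: "has_bochner_integral lborel (\<lambda>x. normal_density 0 \<sigma> x * x ^ 4) (3 * \<sigma> ^ 4)"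
    using normal_moment_even[OF \<open>0 < \<sigma>\<close>, of 0 2] by (simp add: fact_numeral power_divide flip: power_mult)
  then have "integrable lborel (\<lambda>x. normal_density 0 \<sigma> x * x ^ 4)"
    by (simp add: has_bochner_integral_iff)
  then have i: "integrable M (\<lambda>\<omega>. Z \<omega> ^ 4)"
    using distributed_integrable[OF Z, of "\<lambda>x. x ^ 4"] by simp
  have e: "(\<integral>\<omega>. Z \<omega> ^ 4 \<partial>M) = 3 * \<sigma> ^ 4"
    using distributed_integral[OF Z, of "\<lambda>x. x ^ 4"] has_bochner_integral_integral_eq[OF m] by simp
  have "prob {\<omega>\<in>space M. \<delta> < \<bar>Z \<omega>\<bar>} \<le> prob {\<omega>\<in>space M. \<delta> ^ 4 \<le> Z \<omega> ^ 4}"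
  proof (rule finite_measure_mono)
    show "{\<omega>\<in>space M. \<delta> < \<bar>Z \<omega>\<bar>} \<subseteq> {\<omega>\<in>space M. \<delta> ^ 4 \<le> Z \<omega> ^ 4}"
    proof safe
      fix \<omega> assume "\<delta> < \<bar>Z \<omega>\<bar>"
      then have "\<delta> ^ 4 \<le> \<bar>Z \<omega>\<bar> ^ 4" using \<open>0 < \<delta>\<close> by (intro power_mono) auto
      then show "\<delta> ^ 4 \<le> Z \<omega> ^ 4" by simp
    qed
  qed measurable
  also have "\<dots> \<le> (\<integral>\<omega>. Z \<omega> ^ 4 \<partial>M) / \<delta> ^ 4"
    using i \<open>0 < \<delta>\<close> by (intro integral_Markov_inequality_measure[where A="{}"]) auto
  finally show ?thesis by (simp only: e)
qed

section \<open>Upcrossings of Brownian motion\<close>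

text \<open>The start and the continuity of the paths are given only almost surely, so the bar count
  is identified with a measurable function only off a null set. Inside that set its preimages may be
  arbitrary, and the completion contains them.\<close>

lemma borel_measurable_completion_AE_eq:
  assumes g: "g \<in> borel_measurable M" and ae: "AE x in M. f x = g x"
  shows "f \<in> borel_measurable (completion M)"
proof (rule measurableI)
  fix S :: "'b::topological_space set" assume S: "S \<in> sets borel"
  obtain N where N: "N \<in> null_sets M" "{x\<in>space M. f x \<noteq> g x} \<subseteq> N"
    using ae by (auto elim!: AE_E)
  have "f -` S \<inter> space M = (g -` S \<inter> space M - N) \<union> (f -` S \<inter> space M \<inter> N)"
    using N(2) by auto
  moreover have "g -` S \<inter> space M - N \<in> sets (completion M)"
    using N(1) S g by (intro sets_completionI_sets sets.Diff measurable_sets) auto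
  moreover have "f -` S \<inter> space M \<inter> N \<in> sets (completion M)"
    using N(1) by (rule sets_completionI_sub) auto
  ultimately show "f -` S \<inter> space (completion M) \<in> sets (completion M)"
    by (metis sets.Un space_completion)
qed simp

lemma standard_brownian_motion_uminus:
  assumes "standard_brownian_motion M B"
  shows "standard_brownian_motion M (\<lambda>s \<omega>. - B s \<omega>)"
proof -
  interpret standard_brownian_motion M B by fact
  show ?thesis
  proof unfold_locales
    fix \<tau> :: "nat \<Rightarrow> real" and n
    assume "0 \<le> \<tau> 0" "\<And>i. i < n \<Longrightarrow> \<tau> i \<le> \<tau> (Suc i)"
    then have "indep_vars (\<lambda>_. borel) (\<lambda>i \<omega>. - (B (\<tau> (Suc i)) \<omega> - B (\<tau> i) \<omega>)) {..<n}"
      by (intro indep_vars_compose2[OF indep_increments, where Y="\<lambda>_ r. - r"]) auto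
    then show "indep_vars (\<lambda>_. borel) (\<lambda>i \<omega>. - B (\<tau> (Suc i)) \<omega> - - B (\<tau> i) \<omega>) {..<n}"
      by (simp only: minus_diff_minus)
  next
    fix s u :: real assume "0 \<le> s" "s < u"
    then have "distributed M lborel (\<lambda>\<omega>. 0 + (- 1) * (B u \<omega> - B s \<omega>))
        (normal_density (0 + (- 1) * 0) (\<bar>- 1\<bar> * sqrt (u - s)))"
      by (intro normal_density_affine gaussian_increments) auto
    then show "distributed M lborel (\<lambda>\<omega>. - B u \<omega> - - B s \<omega>) (normal_density 0 (sqrt (u - s)))"
      by (simp add: minus_diff_commute)
  next
    show "AE \<omega> in M. - B 0 \<omega> = 0"
      using start_zero by simp
    show "AE \<omega> in M. continuous_on {0..} (\<lambda>s. - B s \<omega>)"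
      using continuous_paths by (auto elim!: eventually_mono intro: continuous_on_minus)
  qed (auto intro: measurable_BM)
qed

context standard_brownian_motion
begin

section \<open>The walk sampled on a dyadic grid\<close>

definition increment :: "real \<Rightarrow> nat \<Rightarrow> nat \<Rightarrow> 'a \<Rightarrow> real" where
  "increment t m i \<omega> = B (real (Suc i) * (t / 2 ^ m)) \<omega> - B (real i * (t / 2 ^ m)) \<omega>"

lemma distributed_increment:
  assumes "0 < t"
  shows "distributed M lborel (increment t m i) (normal_density 0 (sqrt (t / 2 ^ m)))"
proof -
  have "real (Suc i) * (t / 2 ^ m) - real i * (t / 2 ^ m) = t / 2 ^ m"
    by (simp add: algebra_simps add_divide_distrib)
  moreover have "0 < t / 2 ^ m" using assms by simp
  then have "0 \<le> real i * (t / 2 ^ m)" "real i * (t / 2 ^ m) < real (Suc i) * (t / 2 ^ m)"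
    by (auto intro!: mult_strict_right_mono simp del: times_divide_eq_right)
  ultimately show ?thesis
    using gaussian_increments unfolding increment_def[abs_def] by metis
qed

lemma symmetric_walk_increment:
  assumes "0 < t"
  shows "symmetric_walk M (increment t m) (2 ^ m)"
proof unfold_locales
  have "0 \<le> t / 2 ^ m" using assms by simp
  then show "indep_vars (\<lambda>_. borel) (increment t m) {..<2 ^ m}"
    unfolding increment_def[abs_def]
    by (intro indep_increments) (auto intro!: mult_right_mono simp del: times_divide_eq_right)
  fix i :: nat
  let ?\<sigma> = "sqrt (t / 2 ^ m)"
  have X: "distributed M lborel (increment t m i) (normal_density 0 ?\<sigma>)"
    by (rule distributed_increment) fact
  then have "distributed M lborel (\<lambda>\<omega>. 0 + (- 1) * increment t m i \<omega>)
      (normal_density (0 + (- 1) * 0) (\<bar>- 1\<bar> * ?\<sigma>))"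
    using assms by (intro normal_density_affine) auto
  then have "distributed M lborel (\<lambda>\<omega>. - increment t m i \<omega>) (normal_density 0 ?\<sigma>)"
    by simp
  then have "distr M lborel (\<lambda>\<omega>. - increment t m i \<omega>) = distr M lborel (increment t m i)"
    using X by (simp add: distributed_distr_eq_density)
  moreover have "distr M borel f = distr M lborel f" for f :: "'a \<Rightarrow> real"
    by (rule distr_cong) auto
  ultimately show "distr M borel (\<lambda>\<omega>. - increment t m i \<omega>) = distr M borel (increment t m i)"
    by simp
qed simp

lemma walk_increment:
  assumes "0 < t"
  shows "symmetric_walk.walk (increment t m) \<omega> = (\<lambda>i. B (real i * (t / 2 ^ m)) \<omega> - B 0 \<omega>)"
proof
  interpret symmetric_walk M "increment t m" "2 ^ m"
    using assms by (rule symmetric_walk_increment)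
  show "walk \<omega> i = B (real i * (t / 2 ^ m)) \<omega> - B 0 \<omega>" for i
    unfolding walk_def increment_def
    using sum_lessThan_telescope[of "\<lambda>i. B (real i * (t / 2 ^ m)) \<omega>" i] by simp
qed

text \<open>Union bound: there are \<open>2 ^ m\<close> increments, and each is large with
  probability of order \<open>1 / 4 ^ m\<close>.\<close>

lemma prob_increment_tendsto_0:
  assumes "0 < t" "0 < \<delta>"
  shows "(\<lambda>m. prob {\<omega>\<in>space M. \<exists>i<2 ^ m. \<delta> < \<bar>increment t m i \<omega>\<bar>}) \<longlonglongrightarrow> 0"
proof -
  have bound: "prob {\<omega>\<in>space M. \<exists>i<2 ^ m. \<delta> < \<bar>increment t m i \<omega>\<bar>} \<le> 3 * t\<^sup>2 / \<delta> ^ 4 * (1 / 2) ^ m" for m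
  proof -
    let ?A = "\<lambda>i. {\<omega>\<in>space M. \<delta> < \<bar>increment t m i \<omega>\<bar>}"
    have [measurable]: "increment t m i \<in> borel_measurable M" for i
      using distributed_measurable[OF distributed_increment[OF assms(1)]] by simp
    have "{\<omega>\<in>space M. \<exists>i<2 ^ m. \<delta> < \<bar>increment t m i \<omega>\<bar>} = (\<Union>i<2 ^ m. ?A i)" by auto
    also have "prob (\<Union>i<2 ^ m. ?A i) \<le> (\<Sum>i<2 ^ m. prob (?A i))"
      by (intro finite_measure_subadditive_finite) auto
    also have "\<dots> \<le> (\<Sum>i<(2::nat) ^ m. 3 * sqrt (t / 2 ^ m) ^ 4 / \<delta> ^ 4)"
      using assms by (intro sum_mono prob_normal_fourth_moment distributed_increment) auto
    also have "sqrt (t / 2 ^ m) ^ 4 = (t / 2 ^ m)\<^sup>2"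
    proof -
      have "sqrt (t / 2 ^ m) ^ 4 = ((sqrt (t / 2 ^ m))\<^sup>2)\<^sup>2" by (simp flip: power_mult)
      also have "(sqrt (t / 2 ^ m))\<^sup>2 = t / 2 ^ m" using assms by simp
      finally show ?thesis .
    qed
    also have "(\<Sum>i<(2::nat) ^ m. 3 * (t / 2 ^ m)\<^sup>2 / \<delta> ^ 4) = 2 ^ m * (3 * (t / 2 ^ m)\<^sup>2 / \<delta> ^ 4)"
      by simp
    also have "\<dots> = 3 * t\<^sup>2 / \<delta> ^ 4 * (1 / 2 ^ m)"
    proof -
      have "q * (3 * (t / q)\<^sup>2 / D) = 3 * t\<^sup>2 / D * (1 / q)" if "q \<noteq> 0" for q D :: real
        using that by (simp add: power2_eq_square)
      then show ?thesis by simp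
    qed
    finally show ?thesis by (simp only: power_one_over)
  qed
  have "(\<lambda>m. 3 * t\<^sup>2 / \<delta> ^ 4 * (1 / 2) ^ m) \<longlonglongrightarrow> 3 * t\<^sup>2 / \<delta> ^ 4 * 0"
    by (intro tendsto_mult tendsto_const LIMSEQ_realpow_zero) simp_all
  then have "(\<lambda>m. 3 * t\<^sup>2 / \<delta> ^ 4 * (1 / 2) ^ m) \<longlonglongrightarrow> 0" by simp
  from real_tendsto_sandwich[OF _ _ tendsto_const this] bound show ?thesis
    by simp
qed

text \<open>Subtracting \<open>B 0 \<omega>\<close> makes the sampled path a sum of increments
  starting at \<open>0\<close> for every \<omega>, although \<open>B 0 \<omega> = 0\<close> is known
  only almost surely.\<close>

definition stage_event :: "real \<Rightarrow> real \<Rightarrow> real \<Rightarrow> nat \<Rightarrow> nat \<Rightarrow> 'a set" where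
  "stage_event t c h j m =
     {\<omega>\<in>space M. \<exists>i\<le>2 ^ m. stage c h j i (\<lambda>i. B (real i * (t / 2 ^ m)) \<omega> - B 0 \<omega>)}"

lemma stage_event_sets [measurable]:
  assumes "0 < t"
  shows "stage_event t c h j m \<in> events"
proof -
  interpret symmetric_walk M "increment t m" "2 ^ m"
    using assms by (rule symmetric_walk_increment)
  have "{\<omega>\<in>space M. \<exists>i\<le>2 ^ m. stage c h j i (walk \<omega>) \<and> True} \<in> events"
    by (rule measurable_stage_event) simp
  then show ?thesis
    unfolding stage_event_def walk_increment[OF assms] by (simp only: simp_thms)
qed

text \<open>Doubling the indices turns passages on one grid into a chain on the next finer grid, and
  a chain suffices for passages there.\<close>

lemma incseq_stage_event:
  assumes "0 \<le> h" "0 \<le> c + h"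
  shows "incseq (stage_event t c h j)"
proof (rule incseq_SucI, rule subsetI)
  fix m \<omega> assume "\<omega> \<in> stage_event t c h j m"
  then obtain i where i: "\<omega> \<in> space M" "i \<le> 2 ^ m"
      "stage c h j i (\<lambda>i. B (real i * (t / 2 ^ m)) \<omega> - B 0 \<omega>)"
    by (auto simp: stage_event_def)
  obtain s where s: "s 0 = 0" "s j = i" "\<And>k. k < j \<Longrightarrow> s k < s (Suc k) \<and>
      h < (- 1) ^ k * (B (real (s (Suc k)) * (t / 2 ^ m)) \<omega> - B 0 \<omega> - c)"
    using stage_imp_chain[OF i(3)] by blast
  have eq: "real (2 * n) * (t / 2 ^ Suc m) = real n * (t / 2 ^ m)" for n by simp
  have "\<exists>i\<le>2 * s j. stage c h j i (\<lambda>i. B (real i * (t / 2 ^ Suc m)) \<omega> - B 0 \<omega>)"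
  proof (rule chain_imp_stage[where s="\<lambda>k. 2 * s k"])
    show "2 * s k < 2 * s (Suc k) \<and>
        h < (- 1) ^ k * (B (real (2 * s (Suc k)) * (t / 2 ^ Suc m)) \<omega> - B 0 \<omega> - c)" if "k < j" for k
      unfolding eq using s(3)[OF that] by simp
  qed (use assms s(1) in simp_all)
  then obtain l where "l \<le> 2 * s j" "stage c h j l (\<lambda>i. B (real i * (t / 2 ^ Suc m)) \<omega> - B 0 \<omega>)"
    by blast
  then show "\<omega> \<in> stage_event t c h j (Suc m)"
    using i(1,2) s(2) unfolding stage_event_def by (intro CollectI conjI exI[of _ l]) simp_all
qed

lemma prob_stage_event:
  assumes t: "0 < t" and h: "0 \<le> h" "0 \<le> c + h"
  shows "prob (\<Union>m. stage_event t c h (Suc j) m) = erfc ((c + (2 * real j + 1) * h) / sqrt (2 * t))"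
proof -
  let ?Z = "\<lambda>\<omega>. B t \<omega> - B 0 \<omega>" and ?a = "c + (2 * real j + 1) * h"
  let ?g = "\<lambda>a. prob {\<omega>\<in>space M. a < ?Z \<omega>}"
  have Z: "distributed M lborel ?Z (normal_density 0 (sqrt t))"
    using gaussian_increments[of 0 t] t by simp
  have end_walk: "real (2 ^ m) * (t / 2 ^ m) = t" for m :: nat by simp
  have lim: "(\<lambda>m. prob (stage_event t c h (Suc j) m)) \<longlonglongrightarrow> prob (\<Union>m. stage_event t c h (Suc j) m)"
    using t incseq_stage_event[OF h] by (intro finite_Lim_measure_incseq) auto
  \<comment> \<open>No error term and no limit are needed on this side: overshooting only moves the
    mirrored end further out.\<close>
  have upper: "prob (stage_event t c h (Suc j) m) \<le> 2 * ?g ?a" for m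
  proof -
    interpret symmetric_walk M "increment t m" "2 ^ m"
      using t by (rule symmetric_walk_increment)
    have "prob (stage_event t c h (Suc j) m)
        \<le> 2 * prob {\<omega>\<in>space M. h + 2 * real j * h \<le> ?Z \<omega> - c}"
      using prob_stage_le[of c h j] unfolding walk_increment[OF t] end_walk stage_event_def .
    also have "{\<omega>\<in>space M. h + 2 * real j * h \<le> ?Z \<omega> - c} = {\<omega>\<in>space M. ?a \<le> ?Z \<omega>}"
      by (auto simp: algebra_simps)
    finally show ?thesis
      by (simp only: prob_ge_eq_greater_normal[OF Z])
  qed
  \<comment> \<open>With \<delta> fixed, refining the grid removes the error probabilities. The
    remaining shift \<open>(2 * real j + 2) * \<delta>\<close> collects \<open>2 * \<delta>\<close>
    from the last reflection and \<open>2 * \<delta>\<close> from each of the \<open>j\<close>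
    earlier ones.\<close>
  have lower: "2 * ?g (?a + (2 * real j + 2) * \<delta>) \<le> prob (\<Union>m. stage_event t c h (Suc j) m)" if "0 < \<delta>" for \<delta>
  proof (rule LIMSEQ_le_const)
    let ?e = "\<lambda>m. prob {\<omega>\<in>space M. \<exists>i<2 ^ m. \<delta> < \<bar>increment t m i \<omega>\<bar>}"
    have "(\<lambda>m. prob (stage_event t c h (Suc j) m) + (2 * real j + 1) * ?e m)
      \<longlonglongrightarrow> prob (\<Union>m. stage_event t c h (Suc j) m) + (2 * real j + 1) * 0"
      by (intro tendsto_add tendsto_mult tendsto_const lim prob_increment_tendsto_0 t that)
    then show "(\<lambda>m. prob (stage_event t c h (Suc j) m) + (2 * real j + 1) * ?e m)
      \<longlonglongrightarrow> prob (\<Union>m. stage_event t c h (Suc j) m)" by simp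
    have "2 * ?g (?a + (2 * real j + 2) * \<delta>)
        \<le> prob (stage_event t c h (Suc j) m) + (2 * real j + 1) * ?e m" for m
    proof -
      interpret symmetric_walk M "increment t m" "2 ^ m"
        using t by (rule symmetric_walk_increment)
      have "2 * prob {\<omega>\<in>space M. h + 2 * \<delta> + 2 * real j * (h + \<delta>) < ?Z \<omega> - c}
          \<le> prob (stage_event t c h (Suc j) m) + (2 * real j + 1) * ?e m"
        using prob_stage_ge[OF h less_imp_le[OF that], of j]
        unfolding walk_increment[OF t] end_walk stage_event_def .
      also have "{\<omega>\<in>space M. h + 2 * \<delta> + 2 * real j * (h + \<delta>) < ?Z \<omega> - c}
          = {\<omega>\<in>space M. ?a + (2 * real j + 2) * \<delta> < ?Z \<omega>}"
        by (auto simp: algebra_simps)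
      finally show ?thesis .
    qed
    then show "\<exists>N. \<forall>n\<ge>N. 2 * ?g (?a + (2 * real j + 2) * \<delta>)
        \<le> prob (stage_event t c h (Suc j) n) + (2 * real j + 1) * ?e n" by blast
  qed
  have "prob (\<Union>m. stage_event t c h (Suc j) m) \<le> 2 * ?g ?a"
    using lim upper by (intro LIMSEQ_le_const2) auto
  moreover have "2 * ?g ?a \<le> prob (\<Union>m. stage_event t c h (Suc j) m)"
  proof (rule LIMSEQ_le_const2)
    \<comment> \<open>Only now \<delta> tends to \<open>0\<close>, along the reciprocals of the
      positive integers.\<close>
    have "(\<lambda>n. ?a + (2 * real j + 2) * inverse (real (Suc n))) \<longlonglongrightarrow> ?a + (2 * real j + 2) * 0"
      by (intro tendsto_add tendsto_mult tendsto_const LIMSEQ_inverse_real_of_nat)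
    then have "(\<lambda>n. ?a + (2 * real j + 2) * inverse (real (Suc n))) \<longlonglongrightarrow> ?a" by simp
    then show "(\<lambda>n. 2 * ?g (?a + (2 * real j + 2) * inverse (real (Suc n)))) \<longlonglongrightarrow> 2 * ?g ?a"
      by (intro tendsto_mult tendsto_const isCont_tendsto_compose[OF isCont_normal_tail[OF Z]])
    show "\<exists>N. \<forall>n\<ge>N. 2 * ?g (?a + (2 * real j + 2) * inverse (real (Suc n)))
        \<le> prob (\<Union>m. stage_event t c h (Suc j) m)"
      using lower by (intro exI allI impI) simp
  qed
  ultimately have "prob (\<Union>m. stage_event t c h (Suc j) m) = 2 * ?g ?a" by linarith
  then show ?thesis
    by (simp add: normal_tail_erfc[OF Z t])
qed

section \<open>Almost sure agreement of bars and grid passages\<close>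

lemma stage_event_antimono:
  assumes "0 \<le> h'" "h' \<le> h" "0 \<le> c + h'"
  shows "stage_event t c h j m \<subseteq> stage_event t c h' j m"
proof
  fix \<omega> assume "\<omega> \<in> stage_event t c h j m"
  then obtain i where i: "\<omega> \<in> space M" "i \<le> 2 ^ m"
      "stage c h j i (\<lambda>i. B (real i * (t / 2 ^ m)) \<omega> - B 0 \<omega>)"
    by (auto simp: stage_event_def)
  obtain s where s: "s 0 = 0" "s j = i" "\<And>k. k < j \<Longrightarrow> s k < s (Suc k) \<and>
      h < (- 1) ^ k * (B (real (s (Suc k)) * (t / 2 ^ m)) \<omega> - B 0 \<omega> - c)"
    using stage_imp_chain[OF i(3)] by blast
  have "\<exists>i\<le>s j. stage c h' j i (\<lambda>i. B (real i * (t / 2 ^ m)) \<omega> - B 0 \<omega>)"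
    by (rule chain_imp_stage) (use assms s in \<open>force+\<close>)
  then show "\<omega> \<in> stage_event t c h' j m"
    unfolding stage_event_def using i s(2) le_trans by blast
qed

lemma stage_event_imp_bar_count_ge:
  assumes t: "0 < t" and h: "0 < h" and \<omega>: "\<omega> \<in> stage_event t c h (Suc (2 * n)) m" and "B 0 \<omega> = 0"
  shows "of_nat (Suc n) \<le> bar_count (\<lambda>u. B u \<omega>) t (c - h) (c + h)"
proof -
  obtain i where i: "i \<le> 2 ^ m" "stage c h (Suc (2 * n)) i (\<lambda>i. B (real i * (t / 2 ^ m)) \<omega> - B 0 \<omega>)"
    using \<omega> unfolding stage_event_def by blast
  obtain s where s: "s 0 = 0" "s (Suc (2 * n)) = i" "\<And>k. k < Suc (2 * n) \<Longrightarrow> s k < s (Suc k) \<and>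
      h < (- 1) ^ k * (B (real (s (Suc k)) * (t / 2 ^ m)) \<omega> - B 0 \<omega> - c)"
    using stage_imp_chain[OF i(2)] by blast
  show ?thesis
  proof (rule chain_imp_bar_count_ge[where s="\<lambda>k. real (s k) * (t / 2 ^ m)"])
    have "real i \<le> real (2 ^ m)" using i(1) by (simp only: of_nat_le_iff)
    then have "real i * (t / 2 ^ m) \<le> 2 ^ m * (t / 2 ^ m)"
      using t by (intro mult_right_mono) auto
    then show "real (s (Suc (2 * n))) * (t / 2 ^ m) \<le> t"
      unfolding s(2) by simp
    show "real (s k) * (t / 2 ^ m) < real (s (Suc k)) * (t / 2 ^ m)" if "k \<le> 2 * n" for k
      using s(3)[of k] that t by (intro mult_strict_right_mono) auto
    show "c + h \<le> B (real (s (Suc (2 * k))) * (t / 2 ^ m)) \<omega>" if "k \<le> n" for k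
      using s(3)[of "2 * k"] that \<open>B 0 \<omega> = 0\<close> by simp
    show "B (real (s (Suc (Suc (2 * k)))) * (t / 2 ^ m)) \<omega> \<le> c - h" if "k < n" for k
      using s(3)[of "Suc (2 * k)"] that \<open>B 0 \<omega> = 0\<close> by simp
  qed (use s(1) h in simp_all)
qed

text \<open>Bars supply only weak inequalities at the levels. Giving up a little of the half width,
  \<open>h' < h\<close>, makes them strict, and strict inequalities can be moved to a grid. The
  condition \<open>h \<le> c\<close> places the start at or below the lower level.\<close>

lemma bar_count_ge_imp_stage_event:
  assumes t: "0 < t" and h: "0 \<le> h'" "h' < h" "h \<le> c" and \<omega>: "\<omega> \<in> space M" "B 0 \<omega> = 0"
    and cont: "continuous_on {0..} (\<lambda>u. B u \<omega>)"
    and ge: "of_nat (Suc n) \<le> bar_count (\<lambda>u. B u \<omega>) t (c - h) (c + h)"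
  shows "\<omega> \<in> (\<Union>m. stage_event t c h' (Suc (2 * n)) m)"
proof -
  obtain s where s: "s 0 = 0" "s (Suc (2 * n)) \<le> t" "\<And>k. k \<le> 2 * n \<Longrightarrow> s k < s (Suc k)"
      "\<And>k. k \<le> n \<Longrightarrow> c + h \<le> B (s (Suc (2 * k))) \<omega>"
      "\<And>k. k < n \<Longrightarrow> B (s (Suc (Suc (2 * k)))) \<omega> \<le> c - h"
    using bar_count_ge_imp_chain[OF ge] h \<omega> by auto
  have "s k < s (Suc k) \<and> h' < (- 1) ^ k * (B (s (Suc k)) \<omega> - c)" if k: "k < Suc (2 * n)" for k
  proof
    show "s k < s (Suc k)" using s(3) k by simp
    show "h' < (- 1) ^ k * (B (s (Suc k)) \<omega> - c)"
    proof (cases "even k")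
      case True
      then obtain l where l: "k = 2 * l" by auto
      then show ?thesis using s(4)[of l] k h by simp
    next
      case False
      then obtain l where l: "k = Suc (2 * l)" by (metis oddE Suc_eq_plus1)
      then show ?thesis using s(5)[of l] k h by simp
    qed
  qed
  then obtain m \<sigma> where \<sigma>: "\<sigma> 0 = 0" "\<sigma> (Suc (2 * n)) \<le> (2::nat) ^ m"
    "\<And>k. k < Suc (2 * n) \<Longrightarrow> \<sigma> k < \<sigma> (Suc k) \<and>
      h' < (- 1) ^ k * (B (real (\<sigma> (Suc k)) * (t / 2 ^ m)) \<omega> - c)"
    using dyadic_chain[OF continuous_on_subset[OF cont] t s(1,2)] by (metis Icc_subset_Ici_iff order_refl)
  have "\<exists>i\<le>\<sigma> (Suc (2 * n)). stage c h' (Suc (2 * n)) i (\<lambda>i. B (real i * (t / 2 ^ m)) \<omega> - B 0 \<omega>)"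
  proof (rule chain_imp_stage)
    show "\<sigma> k < \<sigma> (Suc k) \<and>
      h' < (- 1) ^ k * (B (real (\<sigma> (Suc k)) * (t / 2 ^ m)) \<omega> - B 0 \<omega> - c)" if "k < Suc (2 * n)" for k
      using \<sigma>(3)[OF that] \<omega>(2) by simp
  qed (use h \<sigma>(1) in simp_all)
  then show ?thesis
    unfolding stage_event_def using \<omega>(1) \<sigma>(2) le_trans by blast
qed

lemma isCont_erfc_scaled:
  assumes "0 < t"
  shows "isCont (\<lambda>a. erfc (a / sqrt (2 * t))) a"
proof -
  have Z: "distributed M lborel (\<lambda>\<omega>. B t \<omega> - B 0 \<omega>) (normal_density 0 (sqrt t))"
    using gaussian_increments[of 0 t] assms by simp
  have "erfc (a / sqrt (2 * t)) = 2 * prob {\<omega>\<in>space M. a < B t \<omega> - B 0 \<omega>}" for a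
    using normal_tail_erfc[OF Z assms, of a] by simp
  then show ?thesis
    using isCont_normal_tail[OF Z] by (simp add: continuous_mult_left)
qed

text \<open>Off a null set the bar event is squeezed between the passage event for \<open>h\<close>
  and the intersection \<open>D\<close> of the passage events for smaller half widths. By continuity
  of \<open>erfc\<close> both bounds have the same probability, so their difference is null.\<close>

lemma AE_bar_count_ge_iff:
  assumes t: "0 < t" and h: "0 < h" "h \<le> c"
  shows "AE \<omega> in M. of_nat (Suc n) \<le> bar_count (\<lambda>u. B u \<omega>) t (c - h) (c + h) \<longleftrightarrow>
     \<omega> \<in> (\<Union>m. stage_event t c h (Suc (2 * n)) m)"
proof -
  let ?A = "\<lambda>h. \<Union>m. stage_event t c h (Suc (2 * n)) m"
  \<comment> \<open>A sequence of half widths in \<open>{0..<h}\<close> tending to \<open>h\<close>,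
    so that countably many events suffice.\<close>
  define hq where "hq q = h * (1 - inverse (real (Suc q)))" for q
  have hq: "0 \<le> hq q" "hq q < h" for q
    unfolding hq_def using h by (auto simp: inverse_le_1_iff)
  have A: "?A h' \<in> events" for h'
    using t by (intro sets.countable_UN) auto
  define D where "D = (\<Inter>q. ?A (hq q))"
  have D: "D \<in> events"
    unfolding D_def by (intro sets.countable_INT) (use A in auto)
  have sub: "?A h \<subseteq> D"
    unfolding D_def
  proof (intro INT_greatest UN_mono order_refl)
    fix q m
    show "stage_event t c h (Suc (2 * n)) m \<subseteq> stage_event t c (hq q) (Suc (2 * n)) m"
      using hq[of q] h by (intro stage_event_antimono) linarith+
  qed
  let ?e = "\<lambda>h. erfc ((c + (2 * real (2 * n) + 1) * h) / sqrt (2 * t))"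
  have "prob D \<le> ?e h"
  proof (rule LIMSEQ_le_const)
    have "(\<lambda>q. h * (1 - inverse (real (Suc q)))) \<longlonglongrightarrow> h * (1 - 0)"
      by (intro tendsto_mult tendsto_diff tendsto_const LIMSEQ_inverse_real_of_nat)
    then have "hq \<longlonglongrightarrow> h" unfolding hq_def[abs_def] by simp
    then show "(\<lambda>q. ?e (hq q)) \<longlonglongrightarrow> ?e h"
      by (intro isCont_tendsto_compose[OF isCont_erfc_scaled[OF t]] tendsto_add tendsto_mult tendsto_const)
    have "prob D \<le> ?e (hq q)" for q
    proof -
      have "prob D \<le> prob (?A (hq q))"
        using A by (intro finite_measure_mono) (auto simp: D_def)
      also have "\<dots> = ?e (hq q)"
        using hq[of q] h t by (intro prob_stage_event) auto
      finally show ?thesis .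
    qed
    then show "\<exists>N. \<forall>q\<ge>N. prob D \<le> ?e (hq q)" by blast
  qed
  also have "?e h = prob (?A h)"
    using h t by (intro prob_stage_event[symmetric]) auto
  finally have "prob (D - ?A h) \<le> 0"
    using finite_measure_Diff[OF D A sub] by simp
  then have "D - ?A h \<in> null_sets M"
    using D A by (simp only: null_sets_def mem_Collect_eq emeasure_eq_measure ennreal_eq_0_iff sets.Diff)
  then have "AE \<omega> in M. \<omega> \<notin> D - ?A h" by (rule AE_not_in)
  with start_zero continuous_paths AE_space show ?thesis
  proof eventually_elim
    case (elim \<omega>)
    show ?case
    proof
      assume "of_nat (Suc n) \<le> bar_count (\<lambda>u. B u \<omega>) t (c - h) (c + h)"
      then have "\<omega> \<in> D"
        unfolding D_def using bar_count_ge_imp_stage_event[OF t hq h(2)] elim by blast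
      then show "\<omega> \<in> ?A h" using elim by blast
    next
      assume "\<omega> \<in> ?A h"
      then show "of_nat (Suc n) \<le> bar_count (\<lambda>u. B u \<omega>) t (c - h) (c + h)"
        using stage_event_imp_bar_count_ge[OF t h(1)] elim by blast
    qed
  qed
qed

section \<open>Summation over the number of bars\<close>

lemma summable_erfc_scaled:
  assumes t: "0 < t" and "0 \<le> x" "0 < \<epsilon>"
  shows "summable (\<lambda>k::nat. erfc ((x + (2 * real k + 1) * \<epsilon>) / sqrt (2 * t)))"
proof (rule summable_comparison_test)
  let ?a = "\<lambda>k. x + (2 * real k + 1) * \<epsilon>"
  have Z: "distributed M lborel (\<lambda>\<omega>. B t \<omega> - B 0 \<omega>) (normal_density 0 (sqrt t))"
    using gaussian_increments[of 0 t] assms by simp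
  have [measurable]: "(\<lambda>\<omega>. B t \<omega> - B 0 \<omega>) \<in> borel_measurable M"
    using distributed_measurable[OF Z] by simp
  have "norm (erfc (?a k / sqrt (2 * t))) \<le> 6 * sqrt t ^ 4 / \<epsilon> ^ 4 * inverse (real (Suc k) ^ 4)" for k
  proof -
    \<comment> \<open>Since \<open>2 * k + 1 \<ge> k + 1\<close> and \<open>x \<ge> 0\<close>, the
      fourth-moment bound applies at the positive distance \<open>real (Suc k) * \<epsilon>\<close>
      and gives decay of order \<open>1 / (k + 1) ^ 4\<close>.\<close>
    have a: "real (Suc k) * \<epsilon> \<le> ?a k" "0 < real (Suc k) * \<epsilon>"
      using assms by (simp_all add: algebra_simps add_pos_nonneg)
    have "erfc (?a k / sqrt (2 * t)) = 2 * prob {\<omega>\<in>space M. ?a k < B t \<omega> - B 0 \<omega>}"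
      using normal_tail_erfc[OF Z t, of "?a k"] by simp
    moreover have "prob {\<omega>\<in>space M. ?a k < B t \<omega> - B 0 \<omega>}
        \<le> prob {\<omega>\<in>space M. real (Suc k) * \<epsilon> < \<bar>B t \<omega> - B 0 \<omega>\<bar>}"
      using a by (intro finite_measure_mono) auto
    moreover have "\<dots> \<le> 3 * sqrt t ^ 4 / (real (Suc k) * \<epsilon>) ^ 4"
      using prob_normal_fourth_moment[OF Z _ a(2)] t by simp
    ultimately show ?thesis
      by (simp add: power_mult_distrib divide_inverse mult_ac)
  qed
  then show "\<exists>N. \<forall>k\<ge>N. norm (erfc (?a k / sqrt (2 * t))) \<le> 6 * sqrt t ^ 4 / \<epsilon> ^ 4 * inverse (real (Suc k) ^ 4)"
    by blast
  have "summable (\<lambda>k. inverse (real k ^ 4))" by (rule inverse_power_summable) simp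
  then have "summable (\<lambda>k. inverse (real (Suc k) ^ 4))"
    by (subst summable_Suc_iff[of "\<lambda>k. inverse (real k ^ 4)"])
  then show "summable (\<lambda>k. 6 * sqrt t ^ 4 / \<epsilon> ^ 4 * inverse (real (Suc k) ^ 4))"
    by (rule summable_mult)
qed

text \<open>A measurable version \<open>g\<close> is supplied rather than just the integral of the
  count, because adding the integrals for \<open>B\<close> and \<open>- B\<close> uses measurability
  of the integrands.\<close>

lemma bar_count_AE_eq_nn_integral:
  assumes t: "0 < t" and "0 \<le> x" "0 < \<epsilon>"
  obtains g where "g \<in> borel_measurable M" "AE \<omega> in M. bar_count (\<lambda>u. B u \<omega>) t x (x + \<epsilon>) = g \<omega>"
    "(\<integral>\<^sup>+ \<omega>. g \<omega> \<partial>M) = ennreal (\<Sum>k::nat. erfc ((x + (2 * real k + 1) * \<epsilon>) / sqrt (2 * t)))"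
proof
  define h where "h = \<epsilon> / 2"
  define c where "c = x + \<epsilon> / 2"
  have h: "0 < h" "h \<le> c" and levels: "c - h = x" "c + h = x + \<epsilon>"
    using assms by (auto simp: h_def c_def)
  let ?A = "\<lambda>n. \<Union>m. stage_event t c h (Suc (2 * n)) m"
  have A: "?A n \<in> events" for n
    using t by (intro sets.countable_UN) auto
  show "(\<lambda>\<omega>. \<Sum>n. indicator (?A n) \<omega> :: ennreal) \<in> borel_measurable M"
    using A by (intro borel_measurable_suminf_order borel_measurable_indicator) auto
  have "AE \<omega> in M. \<forall>n. of_nat (Suc n) \<le> bar_count (\<lambda>u. B u \<omega>) t x (x + \<epsilon>) \<longleftrightarrow> \<omega> \<in> ?A n"
    using AE_bar_count_ge_iff[OF t h] unfolding levels AE_all_countable by blast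
  then show "AE \<omega> in M. bar_count (\<lambda>u. B u \<omega>) t x (x + \<epsilon>) = (\<Sum>n. indicator (?A n) \<omega>)"
  proof eventually_elim
    case (elim \<omega>)
    have "bar_count (\<lambda>u. B u \<omega>) t x (x + \<epsilon>)
        = (\<Sum>n. indicator {n. of_nat (Suc n) \<le> bar_count (\<lambda>u. B u \<omega>) t x (x + \<epsilon>)} n)"
      unfolding bar_count_def by (rule emeasure_count_space_eq_suminf)
    also have "\<dots> = (\<Sum>n. indicator (?A n) \<omega>)"
      using elim by (intro suminf_cong) (simp only: indicator_def mem_Collect_eq)
    finally show ?case .
  qed
  have "(\<integral>\<^sup>+ \<omega>. (\<Sum>n. indicator (?A n) \<omega>) \<partial>M) = (\<Sum>n. \<integral>\<^sup>+ \<omega>. indicator (?A n) \<omega> \<partial>M)"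
    using A by (intro nn_integral_suminf borel_measurable_indicator) auto
  also have "\<dots> = (\<Sum>n. ennreal (prob (?A n)))"
    using A by (intro suminf_cong) (simp only: nn_integral_indicator emeasure_eq_measure)
  also have "\<dots> = (\<Sum>n. ennreal (erfc ((x + (2 * real n + 1) * \<epsilon>) / sqrt (2 * t))))"
  proof (intro suminf_cong)
    fix n
    have "prob (?A n) = erfc ((c + (2 * real (2 * n) + 1) * h) / sqrt (2 * t))"
      using h t by (intro prob_stage_event) auto
    \<comment> \<open>Having \<open>n + 1\<close> bars means \<open>2 * n + 1\<close> passages, so
      the earlier formula is used with \<open>j = 2 * n\<close>. The \<open>4 * n + 1\<close> half
      widths and the offset of the centre \<open>c\<close> from \<open>x\<close> add up to
      \<open>2 * n + 1\<close> full widths.\<close>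
    also have "c + (2 * real (2 * n) + 1) * h = x + (2 * real n + 1) * \<epsilon>"
      by (simp add: c_def h_def field_simps)
    finally show "ennreal (prob (?A n)) = ennreal (erfc ((x + (2 * real n + 1) * \<epsilon>) / sqrt (2 * t)))"
      by simp
  qed
  also have "\<dots> = ennreal (\<Sum>k::nat. erfc ((x + (2 * real k + 1) * \<epsilon>) / sqrt (2 * t)))"
    by (intro suminf_ennreal_eq summable_sums summable_erfc_scaled assms erfc_nonneg)
  finally show "(\<integral>\<^sup>+ \<omega>. (\<Sum>n. indicator (?A n) \<omega>) \<partial>M)
      = ennreal (\<Sum>k::nat. erfc ((x + (2 * real k + 1) * \<epsilon>) / sqrt (2 * t)))" .
qed

end

theorem proposition4p13:
  fixes M :: "'a measure" and B :: "real \<Rightarrow> 'a \<Rightarrow> real" and t x \<epsilon> :: real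
  assumes "standard_brownian_motion M B"
    and "t > 0" and "x > 0" and "\<epsilon> > 0"
  shows "(\<lambda>\<omega>. bar_count (\<lambda>u. \<bar>B u \<omega>\<bar>) t x (x + \<epsilon>)) \<in> borel_measurable (completion M)
       \<and> summable (\<lambda>k::nat. erfc ((x + (2 * real k + 1) * \<epsilon>) / sqrt (2 * t)))
       \<and> (\<integral>\<^sup>+ \<omega>. bar_count (\<lambda>u. \<bar>B u \<omega>\<bar>) t x (x + \<epsilon>) \<partial>M)
           = ennreal (2 * (\<Sum>k::nat. erfc ((x + (2 * real k + 1) * \<epsilon>) / sqrt (2 * t))))"
proof -
  interpret standard_brownian_motion M B by fact
  interpret neg: standard_brownian_motion M "\<lambda>s \<omega>. - B s \<omega>"
    by (rule standard_brownian_motion_uminus) fact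
  let ?S = "\<Sum>k::nat. erfc ((x + (2 * real k + 1) * \<epsilon>) / sqrt (2 * t))"
  have x: "0 \<le> x" using assms by simp
  obtain g where g: "g \<in> borel_measurable M" "AE \<omega> in M. bar_count (\<lambda>u. B u \<omega>) t x (x + \<epsilon>) = g \<omega>"
      "(\<integral>\<^sup>+ \<omega>. g \<omega> \<partial>M) = ennreal ?S"
    using bar_count_AE_eq_nn_integral[OF assms(2) x assms(4)] by blast
  obtain g' where g': "g' \<in> borel_measurable M" "AE \<omega> in M. bar_count (\<lambda>u. - B u \<omega>) t x (x + \<epsilon>) = g' \<omega>"
      "(\<integral>\<^sup>+ \<omega>. g' \<omega> \<partial>M) = ennreal ?S"
    using neg.bar_count_AE_eq_nn_integral[OF assms(2) x assms(4)] by blast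
  have ae: "AE \<omega> in M. bar_count (\<lambda>u. \<bar>B u \<omega>\<bar>) t x (x + \<epsilon>) = g \<omega> + g' \<omega>"
    using g(2) g'(2) continuous_paths
  proof eventually_elim
    case (elim \<omega>)
    have "continuous_on {0..t} (\<lambda>u. B u \<omega>)"
      using elim(3) by (rule continuous_on_subset) auto
    from bar_count_abs[OF this x] elim(1,2) show ?case by simp
  qed
  have summable: "summable (\<lambda>k::nat. erfc ((x + (2 * real k + 1) * \<epsilon>) / sqrt (2 * t)))"
    using assms(2) x assms(4) by (rule summable_erfc_scaled)
  have nonneg: "0 \<le> ?S"
    using summable by (intro suminf_nonneg erfc_nonneg)
  have "(\<integral>\<^sup>+ \<omega>. bar_count (\<lambda>u. \<bar>B u \<omega>\<bar>) t x (x + \<epsilon>) \<partial>M) = (\<integral>\<^sup>+ \<omega>. g \<omega> + g' \<omega> \<partial>M)"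
    using ae by (rule nn_integral_cong_AE)
  also have "\<dots> = (\<integral>\<^sup>+ \<omega>. g \<omega> \<partial>M) + (\<integral>\<^sup>+ \<omega>. g' \<omega> \<partial>M)"
    using g(1) g'(1) by (rule nn_integral_add)
  also have "\<dots> = ennreal (2 * ?S)"
    using nonneg by (simp add: g(3) g'(3) flip: ennreal_plus)
  finally have "(\<integral>\<^sup>+ \<omega>. bar_count (\<lambda>u. \<bar>B u \<omega>\<bar>) t x (x + \<epsilon>) \<partial>M) = ennreal (2 * ?S)" .
  moreover have "(\<lambda>\<omega>. bar_count (\<lambda>u. \<bar>B u \<omega>\<bar>) t x (x + \<epsilon>)) \<in> borel_measurable (completion M)"
    using ae by (rule borel_measurable_completion_AE_eq[rotated]) (intro borel_measurable_add g(1) g'(1))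
  ultimately show ?thesis using summable by blast
qed

end
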